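(* Consider the SEA model (see context) on $\mathcal{X}\subseteq\mathbb{R}^d$ with horizon $T$ (no smoothness assumed). Assume there are constants $G,D>0$ such that: (i) $\max_{\mathbf{x}\in\mathcal{X}}\|\nabla f_t(\mathbf{x})\|_2\le G$ for every individual function $f_t$, $t\in[T]$; (ii) $\mathbf{0}\in\mathcal{X}$ and $\|\mathbf{x}-\mathbf{y}\|_2\le D$ for all $\mathbf{x},\mathbf{y}\in\mathcal{X}$; (iii) every individual function $f_t$, $t\in[T]$, is convex on $\mathcal{X}$. Let $\mathbf{x}_1=\hat{\mathbf{x}}_1$ be any point of $\mathcal{X}$, and run optimistic online mirror descent with an implicit optimistic step, $$\hat{\mathbf{x}}_{t+1}=\Pi_{\mathcal{X}}\big[\hat{\mathbf{x}}_t-\eta_t\nabla f_t(\mathbf{x}_t)\big],\qquad \mathbf{x}_{t+1}=\arg\min_{\mathbf{x}\in\mathcal{X}}f_t(\mathbf{x})+\frac1{2\eta_{t+1}}\|\mathbf{x}-\hat{\mathbf{x}}_{t+1}\|_2^2,$$ where $\Pi_{\mathcal{X}}$ is Euclidean projection onto $\mathcal{X}$ and $$\eta_t=\frac{D}{\sqrt{1+4G^2+\sum_{s=1}^{t-1}\|\nabla f_s(\mathbf{x}_s)-\nabla f_{s-1}(\mathbf{x}_s)\|_2^2}}\quad(t\in[T]),\qquad \eta_{T+1}=\eta_T,$$ with $\nabla f_0\equiv\mathbf 0$. Then for every fixed $\mathbf{u}\in\mathcal{X}$, $$\mathbb{E}\Big[\sum_{t=1}^T f_t(\mathbf{x}_t)-\sum_{t=1}^T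 f_t(\mathbf{u})\Big]\le5D\sqrt{1+G^2}+10\sqrt2\,D\sqrt{\tilde\sigma_{1:T}^2}+10D\sqrt{\Sigma_{1:T}^2}=\mathcal{O}\Big(\sqrt{\tilde\sigma_{1:T}^2}+\sqrt{\Sigma_{1:T}^2}\Big).$$
   Context: SEA (Stochastically Extended Adversarial) model: $[T]=\{1,\dots,T\}$ and $\mathcal{X}\subseteq\mathbb{R}^d$ is a convex feasible domain. In each round $t\in[T]$ the learner selects $\mathbf{x}_t\in\mathcal{X}$; nature chooses a distribution $\mathfrak{D}_t$ over functions (possibly random); then the individual (random) function $f_t$ is sampled from $\mathfrak{D}_t$, and the learner suffers $f_t(\mathbf{x}_t)$ and observes $f_t$. The (conditional) expected function is $F_t(\mathbf{x})=\mathbb{E}_{f_t\sim\mathfrak{D}_t}[f_t(\mathbf{x})]$, with differentiation and expectation interchangeable. "Non-smooth" means that Lipschitz continuity of gradients is not assumed. Define $$\tilde\sigma_t^2=\mathbb{E}_{f_t\sim\mathfrak{D}_t}\Big[\sup_{\mathbf{x}\in\mathcal{X}}\|\nabla f_t(\mathbf{x})-\nabla F_t(\mathbf{x})\|_2^2\Big],\quad \tilde\sigma_{1:T}^2=\mathbb{E}\Big[\sum_{t=1}^T\tilde\sigma_t^2\Big],\quad \Sigma_{1:T}^2=\mathbb{E}\Big[\sum_{t=1}^T\sup_{\mathbf{x}\in\mathcal{X}}\|\nabla F_t(\mathbf{x})-\nabla F_{t-1}(\mathbf{x})\|_2^2\Big],$$ with $\nabla F_0\equiv\mathbf 0$. The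 $\mathcal{O}$-notation treats $D$ and $G$ as constants. *)

theory Defs
  imports "HOL-Probability.Probability" "HOL-Library.Landau_Symbols"
begin

definition grad :: "('a::euclidean_space \<Rightarrow> real) \<Rightarrow> 'a \<Rightarrow> 'a" where
  "grad h x = (THE g. GDERIV h x :> g)"

text \<open>Gradient of the \<open>t\<close>-th member of a sequence of functions indexed by rounds
  \<open>1, 2, \<dots>\<close>, with the convention that the gradient of the (nonexistent) function of
  round \<open>0\<close> vanishes identically. The value of \<open>h 0\<close> is never used.\<close>

definition round_grad :: "(nat \<Rightarrow> 'a::euclidean_space \<Rightarrow> real) \<Rightarrow> nat \<Rightarrow> 'a \<Rightarrow> 'a" where
  "round_grad h t x = (if t = 0 then 0 else grad (h t) x)"

text \<open>In what follows \<open>P\<close> is a distribution over functions: a probability measure on some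
  measurable space whose points are real functions on the ambient Euclidean space.\<close>

definition expected_fun :: "('a::euclidean_space \<Rightarrow> real) measure \<Rightarrow> 'a \<Rightarrow> real" where
  "expected_fun P x = (\<integral>g. g x \<partial>P)"

definition sup_noise ::
  "'a::euclidean_space set \<Rightarrow> ('a \<Rightarrow> real) measure \<Rightarrow> ('a \<Rightarrow> real) \<Rightarrow> real" where
  "sup_noise X P g = (SUP x\<in>X. (norm (grad g x - grad (expected_fun P) x))\<^sup>2)"

definition sigma_sq :: "'a::euclidean_space set \<Rightarrow> ('a \<Rightarrow> real) measure \<Rightarrow> real" where
  "sigma_sq X P = (\<integral>g. sup_noise X P g \<partial>P)"

definition sup_drift ::
  "'a::euclidean_space set \<Rightarrow> (nat \<Rightarrow> ('a \<Rightarrow> real) measure) \<Rightarrow> nat \<Rightarrow> real" where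
  "sup_drift X P t =
     (SUP x\<in>X. (norm (round_grad (\<lambda>s. expected_fun (P s)) t x
                     - round_grad (\<lambda>s. expected_fun (P s)) (t - 1) x))\<^sup>2)"

definition cum_sigma_sq ::
  "'w measure \<Rightarrow> nat \<Rightarrow> 'a::euclidean_space set \<Rightarrow> (nat \<Rightarrow> 'w \<Rightarrow> ('a \<Rightarrow> real) measure) \<Rightarrow> real" where
  "cum_sigma_sq M T X Dist = (\<integral>\<omega>. (\<Sum>t=1..T. sigma_sq X (Dist t \<omega>)) \<partial>M)"

definition cum_Sigma_sq ::
  "'w measure \<Rightarrow> nat \<Rightarrow> 'a::euclidean_space set \<Rightarrow> (nat \<Rightarrow> 'w \<Rightarrow> ('a \<Rightarrow> real) measure) \<Rightarrow> real" where
  "cum_Sigma_sq M T X Dist = (\<integral>\<omega>. (\<Sum>t=1..T. sup_drift X (\<lambda>s. Dist s \<omega>) t) \<partial>M)"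

text \<open>The SEA model with horizon \<open>T\<close> on the feasible domain \<open>X\<close>.

  The points of the measurable space \<open>S\<close> are the individual functions that nature may produce.
  They are total functions on the ambient space, but only their behaviour at (and, for the full
  gradient, infinitesimally around) points of \<open>X\<close> matters.
  \<open>Hist t\<close> is the information present in round \<open>t\<close> just before the individual function
  \<open>f t\<close> is drawn: it contains the previously revealed functions and nature's (possibly random
  and adaptive) choice of the distribution \<open>Dist t\<close>. Given \<open>Hist t\<close>, the
  function \<open>f t\<close> has conditional law \<open>Dist t\<close>.

  The last four assumptions only say that evaluations, gradients and the suprema over the
  (uncountable) set \<open>X\<close> are measurable, so that the expectations defined above are
  meaningful.\<close>

locale sea_model = prob_space M
  for M :: "'w measure" +
  fixes T :: nat
    and X :: "'a::euclidean_space set"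
    and S :: "('a \<Rightarrow> real) measure"
    and Hist :: "nat \<Rightarrow> 'w measure"
    and Dist :: "nat \<Rightarrow> 'w \<Rightarrow> ('a \<Rightarrow> real) measure"
    and f :: "nat \<Rightarrow> 'w \<Rightarrow> 'a \<Rightarrow> real"
  assumes convex_domain: "convex X"
    and hist_subalgebra: "\<And>t. t \<in> {1..T} \<Longrightarrow> subalgebra M (Hist t)"
    and hist_mono: "\<And>s t. 1 \<le> s \<Longrightarrow> s \<le> t \<Longrightarrow> t \<le> T \<Longrightarrow> subalgebra (Hist t) (Hist s)"
    and sample_measurable: "\<And>t. t \<in> {1..T} \<Longrightarrow> f t \<in> M \<rightarrow>\<^sub>M S"
    and sample_revealed: "\<And>s t. 1 \<le> s \<Longrightarrow> s < t \<Longrightarrow> t \<le> T \<Longrightarrow> f s \<in> Hist t \<rightarrow>\<^sub>M S"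
    and dist_chosen: "\<And>t. t \<in> {1..T} \<Longrightarrow> Dist t \<in> Hist t \<rightarrow>\<^sub>M prob_algebra S"
    and sample_law: "\<And>t A. t \<in> {1..T} \<Longrightarrow> A \<in> sets S \<Longrightarrow>
          AE \<omega> in M. real_cond_exp M (Hist t) (\<lambda>\<omega>'. indicator A (f t \<omega>')) \<omega> = measure (Dist t \<omega>) A"
    and differentiable: "\<And>g x. g \<in> space S \<Longrightarrow> x \<in> X \<Longrightarrow> g differentiable (at x)"
    and expectation_finite: "\<And>t \<omega> x. t \<in> {1..T} \<Longrightarrow> \<omega> \<in> space M \<Longrightarrow> x \<in> X \<Longrightarrow>
          integrable (Dist t \<omega>) (\<lambda>g. g x)"
    and interchange: "\<And>t \<omega> x. t \<in> {1..T} \<Longrightarrow> \<omega> \<in> space M \<Longrightarrow> x \<in> X \<Longrightarrow>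
          GDERIV (expected_fun (Dist t \<omega>)) x :> (\<integral>g. grad g x \<partial>(Dist t \<omega>))"
    and eval_measurable:
          "(\<lambda>(g, x). g x) \<in> borel_measurable (S \<Otimes>\<^sub>M restrict_space borel X)"
    and grad_measurable:
          "(\<lambda>(g, x). grad g x) \<in> borel_measurable (S \<Otimes>\<^sub>M restrict_space borel X)"
    and noise_measurable: "\<And>t. t \<in> {1..T} \<Longrightarrow>
          (\<lambda>(\<omega>, g). sup_noise X (Dist t \<omega>) g) \<in> borel_measurable (Hist t \<Otimes>\<^sub>M S)"
    and drift_measurable: "\<And>t. t \<in> {1..T} \<Longrightarrow>
          (\<lambda>\<omega>. sup_drift X (\<lambda>s. Dist s \<omega>) t) \<in> borel_measurable M"

text \<open>The algorithm, run on a realised sequence \<open>h\<close> of individual functions.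
  Truncating \<open>t\<close> at \<open>T\<close> makes the step size of round \<open>T + 1\<close> equal to that of
  round \<open>T\<close>.\<close>

definition step_size ::
  "real \<Rightarrow> real \<Rightarrow> nat \<Rightarrow> (nat \<Rightarrow> 'a::euclidean_space \<Rightarrow> real) \<Rightarrow> (nat \<Rightarrow> 'a) \<Rightarrow> nat \<Rightarrow> real" where
  "step_size D G T h x t =
     D / sqrt (1 + 4 * G\<^sup>2 +
       (\<Sum>s\<in>{1..<min t T}. (norm (round_grad h s (x s) - round_grad h (s - 1) (x s)))\<^sup>2))"

text \<open>The set \<open>X\<close> is not required to be closed, so instead of \<^const>\<open>closest_point\<close> its
  defining property is used; for closed nonempty convex \<open>X\<close> both minimisers exist and are
  unique.\<close>

definition is_projection :: "'a::euclidean_space set \<Rightarrow> 'a \<Rightarrow> 'a \<Rightarrow> bool" where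
  "is_projection X z p \<longleftrightarrow> is_arg_min (\<lambda>y. dist z y) (\<lambda>y. y \<in> X) p"

definition implicit_oomd_run ::
  "'a::euclidean_space set \<Rightarrow> real \<Rightarrow> real \<Rightarrow> nat \<Rightarrow> (nat \<Rightarrow> 'a \<Rightarrow> real) \<Rightarrow>
   'a \<Rightarrow> (nat \<Rightarrow> 'a) \<Rightarrow> (nat \<Rightarrow> 'a) \<Rightarrow> bool" where
  "implicit_oomd_run X D G T h x1 x xhat \<longleftrightarrow>
     x 1 = x1 \<and> xhat 1 = x1 \<and>
     (\<forall>t\<in>{1..T}.
        is_projection X (xhat t - step_size D G T h x t *\<^sub>R grad (h t) (x t)) (xhat (t + 1)) \<and>
        is_arg_min
          (\<lambda>y. h t y + 1 / (2 * step_size D G T h x (t + 1)) * (norm (y - xhat (t + 1)))\<^sup>2)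
          (\<lambda>y. y \<in> X) (x (t + 1)))"

text \<open>The regime of the \<open>O\<close>-notation: pairs of nonnegative values \<open>(s, v)\<close> of the two
  cumulative quantities with \<open>s + v\<close> tending to infinity. This is what allows an additive
  constant depending only on \<open>D\<close> and \<open>G\<close> to be absorbed; near \<open>(0, 0)\<close> it could not be.\<close>

definition large_nonneg_sum :: "(real \<times> real) filter" where
  "large_nonneg_sum =
     inf (filtercomap (\<lambda>(s, v). s + v) at_top) (principal ({0..} \<times> {0..}))"

end

theory Submission
  imports Defs
begin

text \<open>Write \<open>\<delta> t\<close> for the difference of the gradients of \<open>f t\<close> and \<open>f (t - 1)\<close> at \<open>x t\<close>. The implicit
  step supplies the optimality condition of an optimistic mirror descent step whose hint is the
  gradient of \<open>f (t - 1)\<close> at \<open>x t\<close> itself, so no smoothness is needed to compare the hint with the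
  observed gradient. The optimality conditions of the two steps and the self-confident step sizes bound
  the regret, for every outcome, by a constant plus a multiple of \<open>D\<close> times the square root of
  \<open>\<Sum>t. (norm (\<delta> t))\<^sup>2\<close>. Passing through the expected functions splits \<open>\<delta> t\<close> into the noise of round \<open>t\<close>,
  the drift of the expectations and the noise of round \<open>t - 1\<close>, each dominated by a supremum over \<open>X\<close>.
  Thanks to these suprema the expected noise is found by integrating over the conditional law of \<open>f t\<close>,
  whatever the law of \<open>x t\<close>, and Jensen's inequality moves the expectation inside the
  square roots.\<close>

subsection \<open>First-order conditions\<close>

lemma grad_eqI:
  assumes "GDERIV h x :> d"
  shows "grad h x = d"
  unfolding grad_def
proof (rule the_equality[where P = "\<lambda>g. GDERIV h x :> g", OF assms])
  fix g assume "GDERIV h x :> g"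
  then have "(\<lambda>v. v \<bullet> g) = (\<lambda>v. v \<bullet> d)"
    using assms unfolding gderiv_def by (rule has_derivative_unique)
  then show "g = d"
    using vector_eq_ldot[of g d] by (simp add: fun_eq_iff)
qed

text \<open>The values of the derivative on the basis vectors are the coordinates of the vector
  representing it, so the definite description in \<open>grad\<close> is meaningful at every point
  of differentiability.\<close>

lemma GDERIV_grad:
  assumes "h differentiable (at x)"
  shows "GDERIV h x :> grad h x"
proof -
  obtain L where L: "(h has_derivative L) (at x)"
    using assms by (auto simp: differentiable_def)
  then interpret L: bounded_linear L
    by (rule has_derivative_bounded_linear)
  let ?d = "\<Sum>b\<in>Basis. L b *\<^sub>R b"
  have "L = (\<lambda>v. v \<bullet> ?d)"
  proof
    fix v
    have "L v = L (\<Sum>b\<in>Basis. (v \<bullet> b) *\<^sub>R b)"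
      by (simp add: euclidean_representation)
    also have "\<dots> = v \<bullet> ?d"
      by (simp add: L.sum L.scaleR inner_sum_right mult.commute)
    finally show "L v = v \<bullet> ?d" .
  qed
  with L have "GDERIV h x :> ?d"
    by (simp add: gderiv_def)
  then show ?thesis
    using grad_eqI by metis
qed

text \<open>A point of \<open>X\<close> may lie on its boundary, where only directions into
  \<open>X\<close> are available. The one-sided limit is the form in which convexity on
  \<open>X\<close> and minimality over \<open>X\<close> can be exploited.\<close>

lemma GDERIV_directional:
  assumes "GDERIV h x :> d"
  shows "((\<lambda>s. (h (x + s *\<^sub>R v) - h x) / s) \<longlongrightarrow> d \<bullet> v) (at_right 0)"
proof -
  have "((\<lambda>s. x + s *\<^sub>R v) has_derivative (\<lambda>s. s *\<^sub>R v)) (at 0)"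
    by (auto intro!: derivative_eq_intros)
  moreover have "(h has_derivative (\<lambda>w. w \<bullet> d)) (at (x + 0 *\<^sub>R v))"
    using assms by (simp add: gderiv_def)
  ultimately have "((\<lambda>s. h (x + s *\<^sub>R v)) has_derivative (\<lambda>s. (s *\<^sub>R v) \<bullet> d)) (at 0)"
    by (rule has_derivative_compose)
  then have "((\<lambda>s. h (x + s *\<^sub>R v)) has_real_derivative d \<bullet> v) (at 0)"
    by (simp add: has_field_derivative_def inner_commute mult_commute_abs)
  then have "((\<lambda>s. h (x + s *\<^sub>R v)) has_real_derivative d \<bullet> v) (at_right 0)"
    by (rule has_field_derivative_at_within)
  then show ?thesis
    by (simp add: has_field_derivative_iff)
qed

lemma eventually_segment_in:
  assumes "convex X" "x \<in> X" "y \<in> X"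
  shows "\<forall>\<^sub>F s :: real in at_right 0. 0 < s \<and> s < 1 \<and> x + s *\<^sub>R (y - x) \<in> X"
proof -
  have "\<forall>\<^sub>F s :: real in at_right 0. s \<in> {0<..<1}"
    by (rule eventually_at_right_real) simp
  then show ?thesis
  proof eventually_elim
    case (elim s)
    then have "(1 - s) *\<^sub>R x + s *\<^sub>R y \<in> X"
      using assms by (intro convexD) auto
    then show ?case
      using elim by (simp add: algebra_simps)
  qed
qed

text \<open>Convexity keeps the difference quotients along the segment from \<open>x\<close> to
  \<open>y\<close> below \<open>h y - h x\<close>. Their limit gives the tangent inequality, also at
  boundary points of \<open>X\<close>.\<close>

lemma convex_on_gradient_ineq:
  assumes h: "convex_on X h" "GDERIV h x :> d" and xy: "x \<in> X" "y \<in> X"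
  shows "d \<bullet> (y - x) \<le> h y - h x"
proof (rule tendsto_upperbound[OF GDERIV_directional[OF h(2)]])
  have X: "convex X"
    using h(1) by (rule convex_on_imp_convex)
  show "\<forall>\<^sub>F s in at_right 0. (h (x + s *\<^sub>R (y - x)) - h x) / s \<le> h y - h x"
    using eventually_segment_in[OF X xy]
  proof eventually_elim
    case (elim s)
    have "h ((1 - s) *\<^sub>R x + s *\<^sub>R y) \<le> (1 - s) * h x + s * h y"
      using elim xy by (intro convex_onD[OF h(1)]) auto
    then have "h (x + s *\<^sub>R (y - x)) - h x \<le> (h y - h x) * s"
      by (simp add: algebra_simps)
    then show ?case
      using elim by (simp add: pos_divide_le_eq)
  qed
qed simp

text \<open>Difference quotients from the minimiser along segments into \<open>X\<close> are
  nonnegative, and so is their limit.\<close>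

lemma first_order_minimum:
  assumes X: "convex X" and h: "GDERIV h p :> d"
    and min: "is_arg_min h (\<lambda>y. y \<in> X) p" and y: "y \<in> X"
  shows "0 \<le> d \<bullet> (y - p)"
proof (rule tendsto_lowerbound[OF GDERIV_directional[OF h]])
  have p: "p \<in> X" and le: "\<And>z. z \<in> X \<Longrightarrow> h p \<le> h z"
    using min by (auto simp: is_arg_min_linorder)
  show "\<forall>\<^sub>F s in at_right 0. 0 \<le> (h (p + s *\<^sub>R (y - p)) - h p) / s"
    using eventually_segment_in[OF X p y]
    by eventually_elim (simp add: le)
qed simp

lemma GDERIV_norm_diff_sq: "GDERIV (\<lambda>y. c * (norm (y - z))\<^sup>2) p :> (2 * c) *\<^sub>R (p - z)"
  unfolding gderiv_def power2_norm_eq_inner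
  by (auto intro!: derivative_eq_intros simp: fun_eq_iff algebra_simps inner_commute)

text \<open>Both updates have this shape: the projection with \<open>h = 0\<close> and
  \<open>c = 1\<close>, the implicit step with \<open>h\<close> the last function and
  \<open>c = 1 / (2 * \<eta>)\<close>. The gradient \<open>d\<close> is taken at the new point
  \<open>p\<close>, which is what turns the implicit step into a hint.\<close>

lemma prox_first_order:
  assumes X: "convex X" and h: "GDERIV h p :> d"
    and min: "is_arg_min (\<lambda>y. h y + c * (norm (y - z))\<^sup>2) (\<lambda>y. y \<in> X) p" and y: "y \<in> X"
  shows "0 \<le> (d + (2 * c) *\<^sub>R (p - z)) \<bullet> (y - p)"
  using first_order_minimum[OF X GDERIV_add[OF h GDERIV_norm_diff_sq] min y] .

text \<open>Expand the square around \<open>p\<close>: the tangent inequality and the first-order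
  condition absorb the linear terms, and the square of \<open>y - p\<close> remains. This growth
  pins the minimiser down, which its measurability relies on.\<close>

lemma prox_growth:
  assumes X: "convex X" and h: "convex_on X h" "GDERIV h p :> d"
    and min: "is_arg_min (\<lambda>y. h y + c * (norm (y - z))\<^sup>2) (\<lambda>y. y \<in> X) p" and y: "y \<in> X"
  shows "h p + c * (norm (p - z))\<^sup>2 + c * (norm (y - p))\<^sup>2 \<le> h y + c * (norm (y - z))\<^sup>2"
proof -
  have "p \<in> X"
    using min by (simp add: is_arg_min_def)
  then have "d \<bullet> (y - p) \<le> h y - h p"
    using h y by (intro convex_on_gradient_ineq) auto
  moreover have "0 \<le> (d + (2 * c) *\<^sub>R (p - z)) \<bullet> (y - p)"
    by (rule prox_first_order[OF X h(2) min y])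
  moreover have "c * (norm (y - z))\<^sup>2 =
      c * (norm (p - z))\<^sup>2 + c * (norm (y - p))\<^sup>2 + (2 * c) * ((p - z) \<bullet> (y - p))"
    unfolding power2_norm_eq_inner by (simp add: algebra_simps inner_commute)
  ultimately show ?thesis
    by (simp add: inner_add_left)
qed

text \<open>Squaring the distance preserves minimisers. The zero function and the factor
  \<open>1\<close> are kept so that the objective matches the one in
  \<open>prox_first_order\<close>.\<close>

lemma is_projection_iff_prox:
  "is_projection X z p \<longleftrightarrow>
     is_arg_min (\<lambda>y. (\<lambda>_. 0) y + 1 * (norm (y - z))\<^sup>2) (\<lambda>y. y \<in> X) p"
  by (simp add: is_projection_def is_arg_min_linorder dist_norm norm_minus_commute[of z])

subsection \<open>Measurability of minimisers\<close>

text \<open>Since \<open>X\<close> need not be closed, not even Borel, the minimiser is obtained as a limit: minimise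
  over the first \<open>n\<close> points of a countable dense subset of \<open>X\<close>. The quadratic growth forces these
  finite minimisers, which are measurable, to converge to \<open>p\<close>.\<close>

lemma borel_measurable_strict_minimizer:
  fixes \<phi> :: "'w \<Rightarrow> 'a::euclidean_space \<Rightarrow> real"
  assumes meas: "\<And>y. y \<in> X \<Longrightarrow> (\<lambda>\<omega>. \<phi> \<omega> y) \<in> borel_measurable M"
    and cont: "\<And>\<omega>. \<omega> \<in> space M \<Longrightarrow> continuous_on X (\<phi> \<omega>)"
    and mem: "\<And>\<omega>. \<omega> \<in> space M \<Longrightarrow> p \<omega> \<in> X"
    and pos: "\<And>\<omega>. \<omega> \<in> space M \<Longrightarrow> 0 < c \<omega>"
    and growth: "\<And>\<omega> y. \<omega> \<in> space M \<Longrightarrow> y \<in> X \<Longrightarrow>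
      \<phi> \<omega> (p \<omega>) + c \<omega> * (norm (y - p \<omega>))\<^sup>2 \<le> \<phi> \<omega> y"
  shows "p \<in> borel_measurable M"
proof (cases "X = {}")
  case True
  then have "space M = {}"
    using mem by auto
  then show ?thesis
    by (simp add: measurable_def)
next
  case False
  obtain E where E: "countable E" "E \<subseteq> X" "X \<subseteq> closure E"
    using separable by blast
  have "E \<noteq> {}"
    using False E(3) by auto
  define e where "e = from_nat_into E"
  have range_e: "range e = E"
    unfolding e_def using \<open>E \<noteq> {}\<close> E(1) by (rule range_from_nat_into)
  then have e_in: "e k \<in> X" for k
    using E(2) by auto
  \<comment> \<open>Taking the least index breaks ties, so \<open>K n\<close> is determined by
    countably many comparisons of measurable functions.\<close>
  define K where "K n \<omega> = (LEAST k. \<forall>j\<in>{..n}. \<phi> \<omega> (e k) \<le> \<phi> \<omega> (e j))" for n \<omega>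
  have K_le: "\<phi> \<omega> (e (K n \<omega>)) \<le> \<phi> \<omega> (e j)" if "j \<le> n" for n j \<omega>
  proof -
    have "\<exists>k\<in>{..n}. \<forall>j\<in>{..n}. \<phi> \<omega> (e k) \<le> \<phi> \<omega> (e j)"
      using ex_is_arg_min_if_finite[of "{..n}" "\<lambda>k. \<phi> \<omega> (e k)"] by (auto simp: is_arg_min_linorder)
    then have "\<exists>k. \<forall>j\<in>{..n}. \<phi> \<omega> (e k) \<le> \<phi> \<omega> (e j)"
      by blast
    then have "\<forall>j\<in>{..n}. \<phi> \<omega> (e (K n \<omega>)) \<le> \<phi> \<omega> (e j)"
      unfolding K_def by (rule LeastI_ex)
    then show ?thesis
      using that by simp
  qed
  have [measurable]: "(\<lambda>\<omega>. \<phi> \<omega> (e k)) \<in> borel_measurable M" for k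
    by (rule meas[OF e_in])
  have [measurable]: "K n \<in> measurable M (count_space UNIV)" for n
    unfolding K_def by measurable
  have "(\<lambda>\<omega>. e (K n \<omega>)) \<in> borel_measurable M" for n
    by measurable
  then show ?thesis
  proof (rule borel_measurable_LIMSEQ_metric)
    fix \<omega> assume \<omega>: "\<omega> \<in> space M"
    \<comment> \<open>No value falls below the minimum at \<open>p \<omega>\<close>. By density and
      continuity some \<open>e j\<close> comes arbitrarily close to it in value, and from
      \<open>n = j\<close> on the finite minima do at least as well.\<close>
    have lim: "(\<lambda>n. \<phi> \<omega> (e (K n \<omega>))) \<longlonglongrightarrow> \<phi> \<omega> (p \<omega>)"
    proof (rule order_tendstoI)
      fix a assume "a < \<phi> \<omega> (p \<omega>)"
      moreover have "\<phi> \<omega> (p \<omega>) \<le> \<phi> \<omega> (e (K n \<omega>))" for n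
        using growth[OF \<omega> e_in] pos[OF \<omega>]
        by (smt (verit) mult_nonneg_nonneg zero_le_power2)
      ultimately show "\<forall>\<^sub>F n in sequentially. a < \<phi> \<omega> (e (K n \<omega>))"
        by (intro always_eventually allI) (rule less_le_trans)
    next
      fix a assume a: "\<phi> \<omega> (p \<omega>) < a"
      obtain q where q: "\<And>n. q n \<in> E" "q \<longlonglongrightarrow> p \<omega>"
        using mem[OF \<omega>] E(3) by (auto simp: closure_sequential subset_iff)
      have "(\<lambda>n. \<phi> \<omega> (q n)) \<longlonglongrightarrow> \<phi> \<omega> (p \<omega>)"
        using continuous_on_tendsto_compose[OF cont[OF \<omega>] q(2) mem[OF \<omega>]] q(1) E(2)
        by (auto simp: subset_iff)
      then have "\<forall>\<^sub>F n in sequentially. \<phi> \<omega> (q n) < a"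
        using a by (rule order_tendstoD)
      then obtain n where "\<phi> \<omega> (q n) < a"
        by (auto simp: eventually_sequentially)
      moreover obtain j where "q n = e j"
        using q(1) range_e by blast
      ultimately have j: "\<phi> \<omega> (e j) < a"
        by simp
      show "\<forall>\<^sub>F n in sequentially. \<phi> \<omega> (e (K n \<omega>)) < a"
        using eventually_ge_at_top[of j]
        by eventually_elim (use j K_le in \<open>meson le_less_trans\<close>)
    qed
    \<comment> \<open>Quadratic growth turns convergence of the values into convergence of the
      points.\<close>
    have "(\<lambda>n. (norm (e (K n \<omega>) - p \<omega>))\<^sup>2) \<longlonglongrightarrow> 0"
    proof (rule tendsto_sandwich[where f = "\<lambda>_. 0"])
      show "(\<lambda>n. (\<phi> \<omega> (e (K n \<omega>)) - \<phi> \<omega> (p \<omega>)) / c \<omega>) \<longlonglongrightarrow> 0"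
        by (rule tendsto_divide_zero) (rule LIM_zero[OF lim])
      show "\<forall>\<^sub>F n in sequentially.
          (norm (e (K n \<omega>) - p \<omega>))\<^sup>2 \<le> (\<phi> \<omega> (e (K n \<omega>)) - \<phi> \<omega> (p \<omega>)) / c \<omega>"
      proof (intro always_eventually allI)
        fix n
        show "(norm (e (K n \<omega>) - p \<omega>))\<^sup>2 \<le> (\<phi> \<omega> (e (K n \<omega>)) - \<phi> \<omega> (p \<omega>)) / c \<omega>"
          unfolding pos_le_divide_eq[OF pos[OF \<omega>]]
          using growth[OF \<omega> e_in[of "K n \<omega>"]] by (simp add: mult.commute)
      qed
    qed simp_all
    from tendsto_real_sqrt[OF this] show "(\<lambda>n. e (K n \<omega>)) \<longlonglongrightarrow> p \<omega>"
      by (simp add: tendsto_norm_zero_iff LIM_zero_iff)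
  qed
qed

text \<open>The proximal objective is continuous in \<open>y\<close> and grows quadratically around
  its minimiser by \<open>prox_growth\<close>. Function, weight and centre may all be random, so
  both updates are covered.\<close>

lemma borel_measurable_prox:
  fixes h :: "'w \<Rightarrow> 'a::euclidean_space \<Rightarrow> real"
  assumes X: "convex X"
    and h: "\<And>y. y \<in> X \<Longrightarrow> (\<lambda>\<omega>. h \<omega> y) \<in> borel_measurable M"
    and c[measurable]: "c \<in> borel_measurable M" and z[measurable]: "z \<in> borel_measurable M"
    and conv: "\<And>\<omega>. \<omega> \<in> space M \<Longrightarrow> convex_on X (h \<omega>)"
    and diff: "\<And>\<omega> y. \<omega> \<in> space M \<Longrightarrow> y \<in> X \<Longrightarrow> h \<omega> differentiable (at y)"
    and pos: "\<And>\<omega>. \<omega> \<in> space M \<Longrightarrow> 0 < c \<omega>"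
    and min: "\<And>\<omega>. \<omega> \<in> space M \<Longrightarrow>
      is_arg_min (\<lambda>y. h \<omega> y + c \<omega> * (norm (y - z \<omega>))\<^sup>2) (\<lambda>y. y \<in> X) (p \<omega>)"
  shows "p \<in> borel_measurable M"
proof (rule borel_measurable_strict_minimizer)
  show "(\<lambda>\<omega>. h \<omega> y + c \<omega> * (norm (y - z \<omega>))\<^sup>2) \<in> borel_measurable M" if "y \<in> X" for y
    using h[OF that] by measurable
  show p: "p \<omega> \<in> X" if "\<omega> \<in> space M" for \<omega>
    using min[OF that] by (simp add: is_arg_min_def)
  show "continuous_on X (\<lambda>y. h \<omega> y + c \<omega> * (norm (y - z \<omega>))\<^sup>2)" if "\<omega> \<in> space M" for \<omega>
    using diff[OF that]
    by (intro continuous_intros continuous_at_imp_continuous_on ballI)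
       (rule differentiable_imp_continuous_within)
  show "h \<omega> (p \<omega>) + c \<omega> * (norm (p \<omega> - z \<omega>))\<^sup>2 + c \<omega> * (norm (y - p \<omega>))\<^sup>2
      \<le> h \<omega> y + c \<omega> * (norm (y - z \<omega>))\<^sup>2" if "\<omega> \<in> space M" "y \<in> X" for \<omega> y
    by (rule prox_growth[OF X conv GDERIV_grad[OF diff] min]) (use that p in auto)
qed (rule pos)

subsection \<open>Disintegration along a conditional law\<close>

text \<open>The joint law of \<open>\<omega>\<close> and \<open>f \<omega>\<close> on
  \<open>H\<close> times \<open>S\<close> is that of \<open>M\<close> on \<open>H\<close> followed
  by the kernel \<open>K\<close>. The integrand may depend on \<open>\<omega>\<close> because the
  noise compares \<open>g\<close> with the mean of a distribution that is itself random.\<close>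

lemma nn_integral_disintegration:
  assumes "prob_space M" and sub: "subalgebra M H" and f[measurable]: "f \<in> M \<rightarrow>\<^sub>M S"
    and K: "K \<in> H \<rightarrow>\<^sub>M prob_algebra S"
    and law: "\<And>A. A \<in> sets S \<Longrightarrow>
      AE \<omega> in M. real_cond_exp M H (\<lambda>\<omega>'. indicator A (f \<omega>')) \<omega> = measure (K \<omega>) A"
    and \<phi>[measurable]: "\<phi> \<in> borel_measurable (H \<Otimes>\<^sub>M S)"
  shows "(\<integral>\<^sup>+\<omega>. \<phi> (\<omega>, f \<omega>) \<partial>M) = (\<integral>\<^sup>+\<omega>. (\<integral>\<^sup>+g. \<phi> (\<omega>, g) \<partial>K \<omega>) \<partial>M)"
proof -
  interpret prob_space M by fact
  interpret finite_measure_subalgebra M H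
    by standard (rule sub)
  have K_sub[measurable]: "K \<in> H \<rightarrow>\<^sub>M subprob_algebra S"
    using K by (rule measurable_prob_algebraD)
  have space_H: "space H = space M"
    using sub by (simp add: subalgebra_def)
  have K_prob: "prob_space (K \<omega>)" and K_sets[measurable_cong]: "sets (K \<omega>) = sets S"
    if "\<omega> \<in> space M" for \<omega>
    using measurable_space[OF K] that space_H by (auto simp: space_prob_algebra)
  have pair: "(\<lambda>\<omega>. (\<omega>, f \<omega>)) \<in> M \<rightarrow>\<^sub>M H \<Otimes>\<^sub>M S"
    using measurable_from_subalg[OF sub measurable_ident, unfolded id_def]
    by (intro measurable_Pair) auto
  \<comment> \<open>\<open>R\<close> is \<open>M\<close> seen on the events of \<open>H\<close>
    only; \<open>k \<omega>\<close> freezes the first coordinate at \<open>\<omega>\<close> and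
    draws the second from \<open>K \<omega>\<close>.\<close>
  define R where "R = restr_to_subalg M H"
  define k where "k \<omega> = distr (K \<omega>) (H \<Otimes>\<^sub>M S) (Pair \<omega>)" for \<omega>
  have k: "k \<in> H \<rightarrow>\<^sub>M subprob_algebra (H \<Otimes>\<^sub>M S)"
    unfolding k_def by (rule measurable_distr2[OF _ K_sub]) simp
  then have k_R: "k \<in> R \<rightarrow>\<^sub>M subprob_algebra (H \<Otimes>\<^sub>M S)"
    unfolding R_def by (rule measurable_in_subalg[OF sub])
  have R_ne: "space R \<noteq> {}"
    unfolding R_def using not_empty by (simp add: space_restr_to_subalg)
  have k_emeasure: "emeasure (k \<omega>) (B \<times> A) = indicator B \<omega> * emeasure (K \<omega>) A"
    if "\<omega> \<in> space M" "B \<in> sets H" "A \<in> sets S" for \<omega> A B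
  proof -
    have "Pair \<omega> \<in> K \<omega> \<rightarrow>\<^sub>M H \<Otimes>\<^sub>M S"
      using measurable_Pair1'[of \<omega> H S] that K_sets[OF that(1)] space_H
      by (simp cong: measurable_cong_sets)
    moreover have "Pair \<omega> -` (B \<times> A) \<inter> space (K \<omega>) = (if \<omega> \<in> B then A else {})"
      using sets.sets_into_space[OF that(3)] sets_eq_imp_space_eq[OF K_sets[OF that(1)]] by auto
    ultimately show ?thesis
      using that by (simp add: k_def emeasure_distr)
  qed
  \<comment> \<open>By the hypothesis on conditional laws, the two measures agree on measurable rectangles.\<close>
  have joint_law: "distr M (H \<Otimes>\<^sub>M S) (\<lambda>\<omega>. (\<omega>, f \<omega>)) = R \<bind> k"
  proof (rule measure_eqI_generator_eq[OF Int_stable_pair_measure_generator[of H S]])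
    show "{a \<times> b |a b. a \<in> sets H \<and> b \<in> sets S} \<subseteq> Pow (space H \<times> space S)"
      by (auto dest: sets.sets_into_space)
    show "sets (distr M (H \<Otimes>\<^sub>M S) (\<lambda>\<omega>. (\<omega>, f \<omega>))) =
        sigma_sets (space H \<times> space S) {a \<times> b |a b. a \<in> sets H \<and> b \<in> sets S}"
      by (simp add: sets_pair_measure)
    show "sets (R \<bind> k) = sigma_sets (space H \<times> space S) {a \<times> b |a b. a \<in> sets H \<and> b \<in> sets S}"
      using sets_bind[OF sets_kernel[OF k_R] R_ne] by (simp add: sets_pair_measure)
    show "range (\<lambda>_::nat. space H \<times> space S) \<subseteq> {a \<times> b |a b. a \<in> sets H \<and> b \<in> sets S}"
      by auto
    show "emeasure (distr M (H \<Otimes>\<^sub>M S) (\<lambda>\<omega>. (\<omega>, f \<omega>))) (space H \<times> space S) \<noteq> \<infinity>"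
      using pair by (simp add: emeasure_distr emeasure_eq_measure)
  next
    fix Z assume "Z \<in> {a \<times> b |a b. a \<in> sets H \<and> b \<in> sets S}"
    then obtain B A where Z: "Z = B \<times> A" and B[measurable]: "B \<in> sets H" and A[measurable]: "A \<in> sets S"
      by auto
    have BM[measurable]: "B \<in> sets M"
      using B sub by (auto simp: subalgebra_def)
    have [measurable]: "(\<lambda>\<omega>. measure (K \<omega>) A) \<in> borel_measurable M"
      by (rule measurable_from_subalg[OF sub measurable_compose[OF K_sub measurable_measure_subprob_algebra[OF A]]])
    have ind: "integrable M (\<lambda>\<omega>. indicator A (f \<omega>) :: real)"
      by (rule integrable_const_bound[where B = 1]) auto
    have "emeasure (distr M (H \<Otimes>\<^sub>M S) (\<lambda>\<omega>. (\<omega>, f \<omega>))) Z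
        = emeasure M {\<omega> \<in> space M. \<omega> \<in> B \<and> f \<omega> \<in> A}"
      unfolding Z using pair by (subst emeasure_distr) (auto intro!: arg_cong2[where f = emeasure])
    also have "\<dots> = ennreal (\<integral>\<omega>\<in>B. indicator A (f \<omega>) \<partial>M)"
    proof -
      have "(\<integral>\<omega>\<in>B. indicat_real A (f \<omega>) \<partial>M) = (\<integral>\<omega>. indicat_real {\<omega> \<in> space M. \<omega> \<in> B \<and> f \<omega> \<in> A} \<omega> \<partial>M)"
        unfolding set_lebesgue_integral_def
        by (intro Bochner_Integration.integral_cong) (auto simp: indicator_def)
      then show ?thesis
        by (simp add: emeasure_eq_measure)
    qed
    \<comment> \<open>As \<open>B\<close> is an event of \<open>H\<close>, integrating over it
      allows the indicator to be replaced by its conditional expectation given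
      \<open>H\<close>.\<close>
    also have "(\<integral>\<omega>\<in>B. indicator A (f \<omega>) \<partial>M) =
        (\<integral>\<omega>\<in>B. real_cond_exp M H (\<lambda>\<omega>'. indicator A (f \<omega>')) \<omega> \<partial>M)"
      by (rule real_cond_exp_intA[OF ind B])
    also have "\<dots> = (\<integral>\<omega>\<in>B. measure (K \<omega>) A \<partial>M)"
      unfolding set_lebesgue_integral_def
      using law[OF A] by (intro integral_cong_AE) auto
    also have "ennreal \<dots> = (\<integral>\<^sup>+\<omega>. ennreal (indicator B \<omega> * measure (K \<omega>) A) \<partial>M)"
      unfolding set_lebesgue_integral_def real_scaleR_def
    proof (rule nn_integral_eq_integral[symmetric])
      show "integrable M (\<lambda>\<omega>. indicator B \<omega> * measure (K \<omega>) A)"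
        using prob_space.prob_le_1[OF K_prob]
        by (intro integrable_const_bound[where B = 1]) (auto simp: indicator_def)
    qed simp
    also have "\<dots> = (\<integral>\<^sup>+\<omega>. emeasure (k \<omega>) Z \<partial>M)"
    proof (rule nn_integral_cong)
      fix \<omega> assume \<omega>: "\<omega> \<in> space M"
      interpret K: prob_space "K \<omega>"
        by (rule K_prob[OF \<omega>])
      show "ennreal (indicator B \<omega> * measure (K \<omega>) A) = emeasure (k \<omega>) Z"
        unfolding Z k_emeasure[OF \<omega> B A] by (simp add: K.emeasure_eq_measure indicator_def)
    qed
    also have "\<dots> = (\<integral>\<^sup>+\<omega>. emeasure (k \<omega>) Z \<partial>R)"
      unfolding R_def
      by (rule nn_integral_subalgebra2[symmetric, OF sub])
         (auto intro!: measurable_compose[OF k measurable_emeasure_subprob_algebra] simp: Z)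
    also have "\<dots> = emeasure (R \<bind> k) Z"
      by (rule emeasure_bind[symmetric, OF R_ne k_R]) (simp add: Z)
    finally show "emeasure (distr M (H \<Otimes>\<^sub>M S) (\<lambda>\<omega>. (\<omega>, f \<omega>))) Z = emeasure (R \<bind> k) Z" .
  qed auto
  have "(\<integral>\<^sup>+\<omega>. \<phi> (\<omega>, f \<omega>) \<partial>M) = (\<integral>\<^sup>+z. \<phi> z \<partial>(R \<bind> k))"
    unfolding joint_law[symmetric] by (rule nn_integral_distr[OF pair, symmetric]) simp
  also have "\<dots> = (\<integral>\<^sup>+\<omega>. \<integral>\<^sup>+z. \<phi> z \<partial>k \<omega> \<partial>R)"
    by (rule nn_integral_bind[OF \<phi> k_R])
  also have "\<dots> = (\<integral>\<^sup>+\<omega>. \<integral>\<^sup>+z. \<phi> z \<partial>k \<omega> \<partial>M)"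
    unfolding R_def
    by (rule nn_integral_subalgebra2[OF sub])
       (rule measurable_compose[OF k nn_integral_measurable_subprob_algebra[OF \<phi>]])
  also have "\<dots> = (\<integral>\<^sup>+\<omega>. (\<integral>\<^sup>+g. \<phi> (\<omega>, g) \<partial>K \<omega>) \<partial>M)"
  proof (rule nn_integral_cong)
    fix \<omega> assume \<omega>: "\<omega> \<in> space M"
    have "Pair \<omega> \<in> K \<omega> \<rightarrow>\<^sub>M H \<Otimes>\<^sub>M S"
      using measurable_Pair1'[of \<omega> H S] K_sets[OF \<omega>] \<omega> space_H
      by (simp cong: measurable_cong_sets)
    then show "(\<integral>\<^sup>+z. \<phi> z \<partial>k \<omega>) = (\<integral>\<^sup>+g. \<phi> (\<omega>, g) \<partial>K \<omega>)"
      by (simp add: k_def nn_integral_distr)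
  qed
  finally show ?thesis .
qed

subsection \<open>Pathwise regret\<close>

text \<open>The gap between the two sides is the sum of the squared pairwise distances of
  \<open>a\<close>, \<open>b\<close> and \<open>c\<close>.\<close>

lemma norm_sum3_sq_le:
  fixes a b c :: "'a::real_inner"
  shows "(norm (a + b + c))\<^sup>2 \<le> 3 * ((norm a)\<^sup>2 + (norm b)\<^sup>2 + (norm c)\<^sup>2)"
proof -
  have "0 \<le> (norm (a - b))\<^sup>2 + (norm (b - c))\<^sup>2 + (norm (a - c))\<^sup>2"
    by simp
  also have "\<dots> = 3 * ((norm a)\<^sup>2 + (norm b)\<^sup>2 + (norm c)\<^sup>2) - (norm (a + b + c))\<^sup>2"
    unfolding power2_norm_eq_inner by (simp add: algebra_simps inner_commute)
  finally show ?thesis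
    by simp
qed

text \<open>Each summand is at most twice the increment of the square root: with roots
  \<open>r\<close> before and \<open>r'\<close> after, the new term is
  \<open>r'\<^sup>2 - r\<^sup>2\<close>, at most \<open>2 * (r' - r) * r'\<close>.\<close>

lemma sum_self_normalized_le:
  fixes a :: "nat \<Rightarrow> real"
  assumes "\<And>t. 0 \<le> a t"
  shows "(\<Sum>t=1..n. a t / sqrt (1 + (\<Sum>s=1..t. a s))) \<le> 2 * (sqrt (1 + (\<Sum>t=1..n. a t)) - 1)"
proof (induction n)
  case (Suc n)
  define B where "B = 1 + (\<Sum>t=1..n. a t)"
  define r where "r = sqrt B"
  define r' where "r' = sqrt (B + a (Suc n))"
  have "1 \<le> B"
    unfolding B_def by (simp add: sum_nonneg assms)
  then have r: "r\<^sup>2 = B" "r'\<^sup>2 = B + a (Suc n)" "0 < r'" "r \<le> r'"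
    using assms[of "Suc n"] by (auto simp: r_def r'_def)
  then have "a (Suc n) \<le> 2 * (r' - r) * r'"
    using zero_le_power2[of "r' - r"] by (simp add: power2_eq_square algebra_simps)
  then have "a (Suc n) / r' \<le> 2 * (r' - r)"
    using r(3) by (simp add: pos_divide_le_eq)
  moreover have "1 + (\<Sum>t=1..Suc n. a t) = B + a (Suc n)"
    by (simp add: B_def)
  ultimately show ?case
    using Suc.IH by (simp add: r_def r'_def B_def add.assoc)
qed simp

text \<open>Summation by parts for nondecreasing weights. The slack \<open>C - a (n + 1)\<close> is
  kept in the bound because its sign is what permits replacing \<open>w n\<close> by the larger
  \<open>w (Suc n)\<close>.\<close>

lemma sum_weighted_telescope_le:
  fixes w a :: "nat \<Rightarrow> real"
  assumes "mono w" "0 \<le> w 0" and a: "\<And>t. t \<in> {1..n + 1} \<Longrightarrow> a t \<le> C"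
  shows "(\<Sum>t=1..n. w t * (a t - a (t + 1))) \<le> w n * (C - a (n + 1))"
  using a
proof (induction n)
  case 0
  then show ?case
    using assms(2) by simp
next
  case (Suc n)
  have "(\<Sum>t=1..n. w t * (a t - a (t + 1))) \<le> w n * (C - a (n + 1))"
    using Suc by simp
  also have "\<dots> \<le> w (Suc n) * (C - a (n + 1))"
    using Suc.prems[of "n + 1"] monoD[OF assms(1), of n "Suc n"] by (intro mult_right_mono) auto
  finally show ?case
    by (simp add: algebra_simps)
qed

text \<open>One round: \<open>z\<close> is the current mirror point, \<open>p\<close> the next one,
  \<open>w\<close> the point played, \<open>g\<close> the observed gradient and \<open>m\<close> the
  hint. The hypotheses are the optimality of \<open>p\<close> tested at \<open>u\<close> and that of
  \<open>w\<close> tested at \<open>p\<close>.\<close>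

lemma optimistic_step_ineq:
  fixes g m p u w z :: "'a::real_inner"
  assumes proj: "0 \<le> (\<eta> *\<^sub>R g + p - z) \<bullet> (u - p)"
    and impl: "0 \<le> (\<eta> *\<^sub>R m + w - z) \<bullet> (p - w)"
  shows "\<eta> * (g \<bullet> (w - u)) \<le>
    ((norm (u - z))\<^sup>2 - (norm (u - p))\<^sup>2) / 2 + \<eta>\<^sup>2 * (norm (g - m))\<^sup>2 / 2"
proof -
  \<comment> \<open>The first square is Young's inequality for \<open>\<eta> (g - m) \<bullet> (w - p)\<close>; the last identity is the
    three-point identity applied to both optimality conditions.\<close>
  have "0 \<le> (norm (\<eta> *\<^sub>R (g - m) - (w - p)))\<^sup>2 + (norm (w - z))\<^sup>2"
    by simp
  moreover have "(norm (\<eta> *\<^sub>R (g - m) - (w - p)))\<^sup>2 =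
      \<eta>\<^sup>2 * (norm (g - m))\<^sup>2 - 2 * (\<eta> * ((g - m) \<bullet> (w - p))) + (norm (w - p))\<^sup>2"
    unfolding power2_norm_eq_inner
    by (simp add: inner_diff_left inner_diff_right inner_commute power2_eq_square algebra_simps)
  moreover have "2 * (\<eta> * (g \<bullet> (w - u))) + 2 * ((\<eta> *\<^sub>R g + p - z) \<bullet> (u - p))
        + 2 * ((\<eta> *\<^sub>R m + w - z) \<bullet> (p - w))
      = 2 * (\<eta> * ((g - m) \<bullet> (w - p))) + (norm (u - z))\<^sup>2 - (norm (u - p))\<^sup>2
        - (norm (w - p))\<^sup>2 - (norm (w - z))\<^sup>2"
    unfolding power2_norm_eq_inner by (simp add: inner_commute algebra_simps)
  ultimately show ?thesis
    using proj impl by argo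
qed

section \<open>Regret of the implicit optimistic run along one outcome\<close>

lemma step_size_pos:
  assumes "D > 0"
  shows "0 < step_size D G T h x t"
proof -
  have "0 < 1 + 4 * G\<^sup>2 +
      (\<Sum>s\<in>{1..<min t T}. (norm (round_grad h s (x s) - round_grad h (s - 1) (x s)))\<^sup>2)"
    by (intro add_pos_nonneg) (auto intro!: sum_nonneg add_pos_nonneg)
  then show ?thesis
    using assms by (simp add: step_size_def)
qed

lemma implicit_oomd_runD:
  assumes "implicit_oomd_run X D G T h x1 x xhat"
  shows "x 1 = x1" "xhat 1 = x1"
    and "t \<in> {1..T} \<Longrightarrow>
      is_projection X (xhat t - step_size D G T h x t *\<^sub>R grad (h t) (x t)) (xhat (t + 1))"
    and "t \<in> {1..T} \<Longrightarrow>
      is_arg_min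
        (\<lambda>y. h t y + 1 / (2 * step_size D G T h x (t + 1)) * (norm (y - xhat (t + 1)))\<^sup>2)
        (\<lambda>y. y \<in> X) (x (t + 1))"
  using assms unfolding implicit_oomd_run_def by blast+

lemma implicit_oomd_in_domain:
  assumes "implicit_oomd_run X D G T h x1 x xhat" "x1 \<in> X" "t \<in> {1..T + 1}"
  shows "x t \<in> X \<and> xhat t \<in> X"
proof (cases "t = 1")
  case True
  then show ?thesis
    using implicit_oomd_runD(1,2)[OF assms(1)] assms(2) by simp
next
  case False
  then obtain s where s: "t = s + 1" "s \<in> {1..T}"
    using assms(3) by (cases t) auto
  then show ?thesis
    using implicit_oomd_runD(3,4)[OF assms(1) s(2)] by (simp add: is_projection_def is_arg_min_def)
qed

text \<open>Dividing the inequality of round \<open>t\<close> by \<open>\<eta> t\<close> and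
  summing, the distances telescope to \<open>D * (s T / 2)\<close>, while the squares of
  \<open>\<delta> t\<close> weighted by \<open>1 / s t\<close> form a self-normalised sum worth
  \<open>D * sqrt A\<close>. The first part contributes half of \<open>sqrt A\<close>, whence the
  factor \<open>3 / 2\<close>.\<close>

lemma implicit_oomd_regret:
  fixes h :: "nat \<Rightarrow> 'a::euclidean_space \<Rightarrow> real"
  assumes run: "implicit_oomd_run X D G T h x1 x xhat" and x1: "x1 \<in> X"
    and D: "D > 0" and X: "convex X"
    and diff: "\<And>t y. t \<in> {1..T} \<Longrightarrow> y \<in> X \<Longrightarrow> h t differentiable (at y)"
    and conv: "\<And>t. t \<in> {1..T} \<Longrightarrow> convex_on X (h t)"
    and bound: "\<And>t y. t \<in> {1..T} \<Longrightarrow> y \<in> X \<Longrightarrow> norm (grad (h t) y) \<le> G"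
    and diam: "\<And>y z. y \<in> X \<Longrightarrow> z \<in> X \<Longrightarrow> norm (y - z) \<le> D"
    and u: "u \<in> X"
  shows "(\<Sum>t=1..T. h t (x t)) - (\<Sum>t=1..T. h t u) \<le> D * sqrt (1 + G\<^sup>2)
     + 3 / 2 * D * sqrt (\<Sum>t=1..T. (norm (round_grad h t (x t) - round_grad h (t - 1) (x t)))\<^sup>2)"
proof -
  define \<delta> where "\<delta> t = round_grad h t (x t) - round_grad h (t - 1) (x t)" for t
  define s where "s t = sqrt (1 + 4 * G\<^sup>2 + (\<Sum>r\<in>{1..<t}. (norm (\<delta> r))\<^sup>2))" for t
  define A where "A = (\<Sum>t=1..T. (norm (\<delta> t))\<^sup>2)"
  define \<eta> where "\<eta> t = D / s t" for t
  have \<eta>_eq: "step_size D G T h x t = \<eta> t" if "t \<le> T" for t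
    using that by (simp add: step_size_def \<eta>_def s_def \<delta>_def min_def)
  have rad_pos: "0 < 1 + 4 * G\<^sup>2 + (\<Sum>r\<in>{1..<t}. (norm (\<delta> r))\<^sup>2)" for t
    by (intro add_pos_nonneg) (auto intro!: sum_nonneg add_pos_nonneg)
  then have s_pos: "0 < s t" for t
    by (simp add: s_def)
  have \<eta>_pos: "0 < \<eta> t" for t
    using s_pos D by (simp add: \<eta>_def)
  have s_mono: "mono s"
    unfolding s_def by (intro monoI) (auto intro!: sum_mono2)
  have in_X: "x t \<in> X" "xhat t \<in> X" if "t \<in> {1..T + 1}" for t
    using implicit_oomd_in_domain[OF run x1 that] by auto
  \<comment> \<open>The term \<open>4 * G\<^sup>2\<close> in the step size pays for \<open>\<delta> t\<close>, which is missing from the sum in \<open>s t\<close>.\<close>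
  have \<delta>_le: "(norm (\<delta> t))\<^sup>2 \<le> 4 * G\<^sup>2" if t: "t \<in> {1..T}" for t
  proof -
    have G: "0 \<le> G"
      using norm_ge_zero bound[OF t x1] by (rule order_trans)
    have "norm (round_grad h r (x t)) \<le> G" if "r \<in> {0..T}" for r
      using bound[of r "x t"] in_X[of t] t that G by (cases "r = 0") (auto simp: round_grad_def)
    from this[of t] this[of "t - 1"]
    have "norm (round_grad h t (x t)) \<le> G" "norm (round_grad h (t - 1) (x t)) \<le> G"
      using t by auto
    then have "norm (\<delta> t) \<le> 2 * G"
      unfolding \<delta>_def using norm_triangle_ineq4[of "round_grad h t (x t)" "round_grad h (t - 1) (x t)"]
      by linarith
    then have "(norm (\<delta> t))\<^sup>2 \<le> (2 * G)\<^sup>2"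
      by (rule power_mono) simp
    then show ?thesis
      by simp
  qed
  have step: "h t (x t) - h t u \<le>
      s t * ((norm (u - xhat t))\<^sup>2 - (norm (u - xhat (t + 1)))\<^sup>2) / (2 * D)
      + D / 2 * ((norm (\<delta> t))\<^sup>2 / s t)" if t: "t \<in> {1..T}" for t
  proof -
    let ?g = "grad (h t) (x t)" and ?m = "round_grad h (t - 1) (x t)"
    have xt: "x t \<in> X" and xhat: "xhat (t + 1) \<in> X"
      using in_X t by auto
    have "is_projection X (xhat t - \<eta> t *\<^sub>R ?g) (xhat (t + 1))"
      using implicit_oomd_runD(3)[OF run t] t \<eta>_eq[of t] by simp
    then have "0 \<le> (0 + (2 * 1) *\<^sub>R (xhat (t + 1) - (xhat t - \<eta> t *\<^sub>R ?g))) \<bullet> (u - xhat (t + 1))"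
      unfolding is_projection_iff_prox by (rule prox_first_order[OF X GDERIV_const _ u])
    then have proj: "0 \<le> (\<eta> t *\<^sub>R ?g + xhat (t + 1) - xhat t) \<bullet> (u - xhat (t + 1))"
      by (simp add: algebra_simps)
    \<comment> \<open>For \<open>t = 1\<close> the hint is zero and the two starting points
      coincide. Otherwise \<open>x t\<close> was produced by the implicit step on
      \<open>h (t - 1)\<close> with step size \<open>\<eta> t\<close>.\<close>
    have impl: "0 \<le> (\<eta> t *\<^sub>R ?m + x t - xhat t) \<bullet> (xhat (t + 1) - x t)"
    proof (cases "t = 1")
      case True
      then show ?thesis
        using implicit_oomd_runD(1,2)[OF run] by (simp add: round_grad_def)
    next
      case False
      then obtain r where r: "t = r + 1" "r \<in> {1..T}"
        using t by (cases t) auto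
      have "is_arg_min (\<lambda>y. h r y + 1 / (2 * \<eta> t) * (norm (y - xhat t))\<^sup>2) (\<lambda>y. y \<in> X) (x t)"
        using implicit_oomd_runD(4)[OF run r(2)] r(1) t \<eta>_eq[of t] by simp
      then have "0 \<le> (grad (h r) (x t) + (2 * (1 / (2 * \<eta> t))) *\<^sub>R (x t - xhat t)) \<bullet> (xhat (t + 1) - x t)"
        by (rule prox_first_order[OF X GDERIV_grad[OF diff[OF r(2) xt]] _ xhat])
      then have "0 \<le> \<eta> t * ((grad (h r) (x t) + (1 / \<eta> t) *\<^sub>R (x t - xhat t)) \<bullet> (xhat (t + 1) - x t))"
        using \<eta>_pos[of t] by simp
      also have "\<dots> = (\<eta> t *\<^sub>R grad (h r) (x t) + x t - xhat t) \<bullet> (xhat (t + 1) - x t)"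
        using \<eta>_pos[of t] by (simp add: scaleR_add_right add_diff_eq flip: inner_scaleR_left)
      finally show ?thesis
        using r by (simp add: round_grad_def)
    qed
    have "\<eta> t * (?g \<bullet> (x t - u)) \<le> ((norm (u - xhat t))\<^sup>2 - (norm (u - xhat (t + 1)))\<^sup>2) / 2
        + (\<eta> t)\<^sup>2 * (norm (?g - ?m))\<^sup>2 / 2"
      by (rule optimistic_step_ineq[OF proj impl])
    also have "?g - ?m = \<delta> t"
      using t by (simp add: \<delta>_def round_grad_def)
    \<comment> \<open>Because \<open>\<eta> t * s t = D\<close>, a common factor
      \<open>\<eta> t\<close> comes out and can be cancelled.\<close>
    also have "((norm (u - xhat t))\<^sup>2 - (norm (u - xhat (t + 1)))\<^sup>2) / 2
        + (\<eta> t)\<^sup>2 * (norm (\<delta> t))\<^sup>2 / 2 = \<eta> t *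
        (s t * ((norm (u - xhat t))\<^sup>2 - (norm (u - xhat (t + 1)))\<^sup>2) / (2 * D)
          + D / 2 * ((norm (\<delta> t))\<^sup>2 / s t))"
      using s_pos[of t] D by (simp add: \<eta>_def field_simps power2_eq_square)
    finally have "?g \<bullet> (x t - u) \<le>
        s t * ((norm (u - xhat t))\<^sup>2 - (norm (u - xhat (t + 1)))\<^sup>2) / (2 * D)
          + D / 2 * ((norm (\<delta> t))\<^sup>2 / s t)"
      using \<eta>_pos[of t] by simp
    moreover have "?g \<bullet> (u - x t) \<le> h t u - h t (x t)"
      by (rule convex_on_gradient_ineq[OF conv[OF t] GDERIV_grad[OF diff[OF t xt]] xt u])
    ultimately show ?thesis
      by (simp add: inner_diff_right)
  qed
  have "(\<Sum>t=1..T. h t (x t)) - (\<Sum>t=1..T. h t u) \<le>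
      (\<Sum>t=1..T. s t * ((norm (u - xhat t))\<^sup>2 - (norm (u - xhat (t + 1)))\<^sup>2) / (2 * D)
      + D / 2 * ((norm (\<delta> t))\<^sup>2 / s t))"
    unfolding sum_subtractf[symmetric] by (rule sum_mono[OF step])
  also have "\<dots> = (\<Sum>t=1..T. s t * ((norm (u - xhat t))\<^sup>2 - (norm (u - xhat (t + 1)))\<^sup>2)) / (2 * D)
      + D / 2 * (\<Sum>t=1..T. (norm (\<delta> t))\<^sup>2 / s t)"
    unfolding sum.distrib sum_divide_distrib sum_distrib_left ..
  also have "\<dots> \<le> D * (sqrt (1 + G\<^sup>2) + sqrt A / 2) + D / 2 * (2 * sqrt A)"
  proof (rule add_mono)
    have "(\<Sum>t=1..T. s t * ((norm (u - xhat t))\<^sup>2 - (norm (u - xhat (t + 1)))\<^sup>2))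
        \<le> s T * (D\<^sup>2 - (norm (u - xhat (T + 1)))\<^sup>2)"
      using s_pos[of 0] in_X(2) diam[OF u]
      by (intro sum_weighted_telescope_le s_mono) (auto intro!: power_mono)
    also have "\<dots> \<le> s T * D\<^sup>2"
      using s_pos[of T] by simp
    finally have "(\<Sum>t=1..T. s t * ((norm (u - xhat t))\<^sup>2 - (norm (u - xhat (t + 1)))\<^sup>2)) / (2 * D)
        \<le> s T * D\<^sup>2 / (2 * D)"
      using D by (intro divide_right_mono) auto
    also have "\<dots> = D * (s T / 2)"
      using D by (simp add: power2_eq_square)
    finally have "(\<Sum>t=1..T. s t * ((norm (u - xhat t))\<^sup>2 - (norm (u - xhat (t + 1)))\<^sup>2)) / (2 * D)
        \<le> D * (s T / 2)" .
    \<comment> \<open>The constant comes from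
      \<open>1 + 4 * G\<^sup>2 \<le> 4 * (1 + G\<^sup>2)\<close>.\<close>
    moreover have "s T / 2 \<le> sqrt (1 + G\<^sup>2) + sqrt A / 2"
    proof -
      have "s T \<le> sqrt (1 + 4 * G\<^sup>2 + A)"
        unfolding s_def A_def by (auto intro!: sum_mono2)
      also have "\<dots> \<le> sqrt (1 + 4 * G\<^sup>2) + sqrt A"
        by (rule sqrt_add_le_add_sqrt) (auto simp: A_def intro!: sum_nonneg)
      finally have "s T \<le> sqrt (1 + 4 * G\<^sup>2) + sqrt A" .
      moreover have "sqrt (1 + 4 * G\<^sup>2) \<le> sqrt (2\<^sup>2 * (1 + G\<^sup>2))"
        by simp
      then have "sqrt (1 + 4 * G\<^sup>2) \<le> 2 * sqrt (1 + G\<^sup>2)"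
        unfolding real_sqrt_mult by simp
      ultimately show ?thesis
        by simp
    qed
    ultimately show "(\<Sum>t=1..T. s t * ((norm (u - xhat t))\<^sup>2 - (norm (u - xhat (t + 1)))\<^sup>2)) / (2 * D)
        \<le> D * (sqrt (1 + G\<^sup>2) + sqrt A / 2)"
      using D by (meson mult_left_mono less_imp_le order_trans)
  next
    have "(\<Sum>t=1..T. (norm (\<delta> t))\<^sup>2 / s t) \<le>
        (\<Sum>t=1..T. (norm (\<delta> t))\<^sup>2 / sqrt (1 + (\<Sum>r=1..t. (norm (\<delta> r))\<^sup>2)))"
    proof (rule sum_mono)
      fix t assume t: "t \<in> {1..T}"
      then have "{1..t} = insert t {1..<t}"
        by auto
      then have "sqrt (1 + (\<Sum>r=1..t. (norm (\<delta> r))\<^sup>2)) \<le> s t"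
        unfolding s_def using \<delta>_le[OF t] by simp
      moreover have "0 < 1 + (\<Sum>r=1..t. (norm (\<delta> r))\<^sup>2)"
        by (intro add_pos_nonneg) (auto intro!: sum_nonneg)
      ultimately show "(norm (\<delta> t))\<^sup>2 / s t \<le> (norm (\<delta> t))\<^sup>2 / sqrt (1 + (\<Sum>r=1..t. (norm (\<delta> r))\<^sup>2))"
        by (intro divide_left_mono mult_pos_pos s_pos) auto
    qed
    also have "\<dots> \<le> 2 * (sqrt (1 + A) - 1)"
      unfolding A_def by (rule sum_self_normalized_le) simp
    also have "\<dots> \<le> 2 * sqrt A"
      using sqrt_add_le_add_sqrt[of 1 A] by (simp add: A_def sum_nonneg)
    finally show "D / 2 * (\<Sum>t=1..T. (norm (\<delta> t))\<^sup>2 / s t) \<le> D / 2 * (2 * sqrt A)"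
      using D by (intro mult_left_mono) auto
  qed
  finally show ?thesis
    by (simp add: A_def \<delta>_def algebra_simps)
qed

subsection \<open>Expected regret in the SEA model\<close>

text \<open>Jensen's inequality for the square root, read off from the nonnegative variance of
  \<open>sqrt (Z \<omega>)\<close>. Integrability follows from
  \<open>sqrt z \<le> 1 + z\<close>.\<close>

lemma (in prob_space) expectation_sqrt_le:
  assumes Z: "integrable M Z" and pos: "\<And>\<omega>. \<omega> \<in> space M \<Longrightarrow> 0 \<le> Z \<omega>"
  shows "integrable M (\<lambda>\<omega>. sqrt (Z \<omega>))"
    and "expectation (\<lambda>\<omega>. sqrt (Z \<omega>)) \<le> sqrt (expectation Z)"
proof -
  have [measurable]: "Z \<in> borel_measurable M"
    using Z by auto
  show int: "integrable M (\<lambda>\<omega>. sqrt (Z \<omega>))"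
  proof (rule Bochner_Integration.integrable_bound)
    show "integrable M (\<lambda>\<omega>. 1 + Z \<omega>)"
      using Z by simp
    have "sqrt (Z \<omega>) \<le> 1 + Z \<omega>" if "\<omega> \<in> space M" for \<omega>
      using pos[OF that] by (intro real_le_lsqrt) (auto simp: power2_eq_square algebra_simps)
    then show "AE \<omega> in M. norm (sqrt (Z \<omega>)) \<le> norm (1 + Z \<omega>)"
      using pos by (intro AE_I2) (simp add: add_nonneg_nonneg)
  qed simp
  have sq: "(sqrt (Z \<omega>))\<^sup>2 = Z \<omega>" if "\<omega> \<in> space M" for \<omega>
    using pos[OF that] by simp
  have "0 \<le> variance (\<lambda>\<omega>. sqrt (Z \<omega>))"
    by (rule variance_positive)
  also have "\<dots> = expectation (\<lambda>\<omega>. (sqrt (Z \<omega>))\<^sup>2) - (expectation (\<lambda>\<omega>. sqrt (Z \<omega>)))\<^sup>2"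
    using Z sq by (intro variance_eq int) (simp cong: Bochner_Integration.integrable_cong)
  also have "expectation (\<lambda>\<omega>. (sqrt (Z \<omega>))\<^sup>2) = expectation Z"
    using sq by (rule Bochner_Integration.integral_cong[OF refl])
  finally show "expectation (\<lambda>\<omega>. sqrt (Z \<omega>)) \<le> sqrt (expectation Z)"
    by (intro real_le_rsqrt) simp
qed

text \<open>A real supremum is meaningful only over a nonempty family bounded above; the common
  bound \<open>G\<close> provides the upper bound.\<close>

lemma SUP_norm_diff_sq:
  fixes a b :: "'a \<Rightarrow> 'b::real_normed_vector"
  assumes a: "\<And>y. y \<in> X \<Longrightarrow> norm (a y) \<le> G" and b: "\<And>y. y \<in> X \<Longrightarrow> norm (b y) \<le> G"
    and ne: "X \<noteq> {}"
  shows "y \<in> X \<Longrightarrow> (norm (a y - b y))\<^sup>2 \<le> (SUP y\<in>X. (norm (a y - b y))\<^sup>2)"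
    and "(SUP y\<in>X. (norm (a y - b y))\<^sup>2) \<in> {0..(2 * G)\<^sup>2}"
proof -
  have le: "(norm (a y - b y))\<^sup>2 \<le> (2 * G)\<^sup>2" if "y \<in> X" for y
    using norm_triangle_ineq4[of "a y" "b y"] a[OF that] b[OF that] by (intro power_mono) auto
  then have bdd: "bdd_above ((\<lambda>y. (norm (a y - b y))\<^sup>2) ` X)"
    by (rule bdd_aboveI2)
  then show upper: "(norm (a y - b y))\<^sup>2 \<le> (SUP y\<in>X. (norm (a y - b y))\<^sup>2)" if "y \<in> X" for y
    using that by (rule cSUP_upper[rotated])
  obtain y where "y \<in> X"
    using ne by auto
  with upper have "0 \<le> (SUP y\<in>X. (norm (a y - b y))\<^sup>2)"
    by (meson order_trans zero_le_power2)
  moreover have "(SUP y\<in>X. (norm (a y - b y))\<^sup>2) \<le> (2 * G)\<^sup>2"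
    using ne le by (rule cSUP_least)
  ultimately show "(SUP y\<in>X. (norm (a y - b y))\<^sup>2) \<in> {0..(2 * G)\<^sup>2}"
    by simp
qed

section \<open>Sampled functions and iterates as random variables\<close>

context sea_model
begin

lemma dist_prob_space: "t \<in> {1..T} \<Longrightarrow> \<omega> \<in> space M \<Longrightarrow> prob_space (Dist t \<omega>)"
  and sets_dist: "t \<in> {1..T} \<Longrightarrow> \<omega> \<in> space M \<Longrightarrow> sets (Dist t \<omega>) = sets S"
  using measurable_space[OF dist_chosen, of t \<omega>] hist_subalgebra[of t]
  by (auto simp: space_prob_algebra subalgebra_def)

lemma space_dist: "t \<in> {1..T} \<Longrightarrow> \<omega> \<in> space M \<Longrightarrow> space (Dist t \<omega>) = space S"
  by (rule sets_eq_imp_space_eq[OF sets_dist])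

lemma sample_in_space: "t \<in> {1..T} \<Longrightarrow> \<omega> \<in> space M \<Longrightarrow> f t \<omega> \<in> space S"
  by (rule measurable_space[OF sample_measurable])

text \<open>Evaluation and gradient are jointly measurable over points of \<open>X\<close>; pairing
  the sample with a random point of \<open>X\<close> lets both be composed with the run.\<close>

lemma measurable_sample_pair:
  assumes "t \<in> {1..T}" "z \<in> borel_measurable M" "\<And>\<omega>. \<omega> \<in> space M \<Longrightarrow> z \<omega> \<in> X"
  shows "(\<lambda>\<omega>. (f t \<omega>, z \<omega>)) \<in> M \<rightarrow>\<^sub>M S \<Otimes>\<^sub>M restrict_space borel X"
  using assms by (intro measurable_Pair sample_measurable measurable_restrict_space2) auto

lemma borel_measurable_sample_eval:
  assumes "t \<in> {1..T}" "z \<in> borel_measurable M" "\<And>\<omega>. \<omega> \<in> space M \<Longrightarrow> z \<omega> \<in> X"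
  shows "(\<lambda>\<omega>. f t \<omega> (z \<omega>)) \<in> borel_measurable M"
  using measurable_compose[OF measurable_sample_pair[OF assms] eval_measurable] by simp

lemma borel_measurable_sample_grad:
  assumes "t \<in> {1..T}" "z \<in> borel_measurable M" "\<And>\<omega>. \<omega> \<in> space M \<Longrightarrow> z \<omega> \<in> X"
  shows "(\<lambda>\<omega>. grad (f t \<omega>) (z \<omega>)) \<in> borel_measurable M"
  using measurable_compose[OF measurable_sample_pair[OF assms] grad_measurable] by simp

text \<open>The step size of round \<open>t\<close> involves only iterates of rounds before
  \<open>t\<close>, which lets measurability be propagated from round to round.\<close>

lemma borel_measurable_step_size:
  assumes z: "\<And>s. s \<in> {1..<min t T} \<Longrightarrow> z s \<in> borel_measurable M"
    and z_in: "\<And>s \<omega>. s \<in> {1..<min t T} \<Longrightarrow> \<omega> \<in> space M \<Longrightarrow> z s \<omega> \<in> X"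
  shows "(\<lambda>\<omega>. step_size D G T (\<lambda>t. f t \<omega>) (\<lambda>t. z t \<omega>) t) \<in> borel_measurable M"
proof -
  have "(\<lambda>\<omega>. round_grad (\<lambda>t. f t \<omega>) r (z s \<omega>)) \<in> borel_measurable M"
    if s: "s \<in> {1..<min t T}" and "r \<le> T" for r s
  proof (cases "r = 0")
    case False
    with that show ?thesis
      by (simp add: round_grad_def borel_measurable_sample_grad z z_in)
  qed (simp add: round_grad_def)
  then have [measurable]: "(\<lambda>\<omega>. round_grad (\<lambda>t. f t \<omega>) s (z s \<omega>)) \<in> borel_measurable M"
    "(\<lambda>\<omega>. round_grad (\<lambda>t. f t \<omega>) (s - 1) (z s \<omega>)) \<in> borel_measurable M"
    if "s \<in> {1..<min t T}" for s
    using that by auto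
  show ?thesis
    unfolding step_size_def by measurable
qed

text \<open>The run is prescribed outcome by outcome, so measurability has to be proved: by
  induction on rounds, each new point is a proximal minimiser with measurable data. The mirror point
  comes first, being the centre of the implicit step.\<close>

lemma borel_measurable_iterates:
  assumes D: "D > 0" and conv: "\<And>g. g \<in> space S \<Longrightarrow> convex_on X g" and x1: "x1 \<in> X"
    and run: "\<And>\<omega>. \<omega> \<in> space M \<Longrightarrow>
      implicit_oomd_run X D G T (\<lambda>t. f t \<omega>) x1 (\<lambda>t. x t \<omega>) (\<lambda>t. xhat t \<omega>)"
    and "n \<le> T + 1" "t \<in> {1..n}"
  shows "x t \<in> borel_measurable M \<and> xhat t \<in> borel_measurable M"
  using assms(5,6)
proof (induction n arbitrary: t)
  case 0
  then show ?case
    by simp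
next
  case (Suc n)
  have in_X: "x s \<omega> \<in> X" "xhat s \<omega> \<in> X" if "s \<in> {1..T + 1}" "\<omega> \<in> space M" for s \<omega>
    using implicit_oomd_in_domain[OF run[OF that(2)] x1 that(1)] by auto
  have IH: "x s \<in> borel_measurable M" "xhat s \<in> borel_measurable M" if "s \<in> {1..n}" for s
    using Suc.IH[of s] Suc.prems that by auto
  let ?\<eta> = "\<lambda>s \<omega>. step_size D G T (\<lambda>t. f t \<omega>) (\<lambda>t. x t \<omega>) s"
  consider "t \<in> {1..n}" | "t = 1" | "t = n + 1" "n \<in> {1..T}"
    using Suc.prems by fastforce
  then show ?case
  proof cases
    case 1
    then show ?thesis
      using IH by simp
  next
    case 2
    have "x 1 \<omega> = x1" "xhat 1 \<omega> = x1" if "\<omega> \<in> space M" for \<omega>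
      using implicit_oomd_runD(1,2)[OF run[OF that]] by auto
    then show ?thesis
      using 2 by (simp cong: measurable_cong)
  next
    case 3
    have \<eta>: "?\<eta> s \<in> borel_measurable M" if "s \<le> n + 1" for s
      by (rule borel_measurable_step_size) (use that 3 in \<open>auto intro!: IH in_X\<close>)
    have grad: "(\<lambda>\<omega>. grad (f n \<omega>) (x n \<omega>)) \<in> borel_measurable M"
      using 3 by (intro borel_measurable_sample_grad IH in_X) auto
    have xhat: "xhat (n + 1) \<in> borel_measurable M"
    proof (rule borel_measurable_prox[where h = "\<lambda>_ _. 0" and c = "\<lambda>_. 1"])
      show "(\<lambda>\<omega>. xhat n \<omega> - ?\<eta> n \<omega> *\<^sub>R grad (f n \<omega>) (x n \<omega>)) \<in> borel_measurable M"
        using 3 by (intro borel_measurable_diff borel_measurable_scaleR IH grad \<eta>) auto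
      show "is_arg_min (\<lambda>y. 0 + 1 * (norm (y - (xhat n \<omega> - ?\<eta> n \<omega> *\<^sub>R grad (f n \<omega>) (x n \<omega>))))\<^sup>2)
          (\<lambda>y. y \<in> X) (xhat (n + 1) \<omega>)" if "\<omega> \<in> space M" for \<omega>
        using implicit_oomd_runD(3)[OF run[OF that] 3(2)] unfolding is_projection_iff_prox .
    qed (auto simp: convex_domain convex_on_const)
    have "x (n + 1) \<in> borel_measurable M"
    proof (rule borel_measurable_prox)
      show "convex X"
        by (rule convex_domain)
      show "(\<lambda>\<omega>. f n \<omega> y) \<in> borel_measurable M" if "y \<in> X" for y
        using 3 that by (intro borel_measurable_sample_eval) auto
      show "(\<lambda>\<omega>. 1 / (2 * ?\<eta> (n + 1) \<omega>)) \<in> borel_measurable M"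
        by (intro borel_measurable_divide borel_measurable_times borel_measurable_const \<eta>) simp
      show "convex_on X (f n \<omega>)" if "\<omega> \<in> space M" for \<omega>
        using sample_in_space[OF 3(2) that] by (rule conv)
      show "f n \<omega> differentiable at y" if "\<omega> \<in> space M" "y \<in> X" for \<omega> y
        using sample_in_space[OF 3(2) that(1)] that(2) by (rule differentiable)
      show "0 < 1 / (2 * ?\<eta> (n + 1) \<omega>)" for \<omega>
        using step_size_pos[OF D] by simp
      show "is_arg_min (\<lambda>y. f n \<omega> y + 1 / (2 * ?\<eta> (n + 1) \<omega>) * (norm (y - xhat (n + 1) \<omega>))\<^sup>2)
          (\<lambda>y. y \<in> X) (x (n + 1) \<omega>)" if "\<omega> \<in> space M" for \<omega>
        by (rule implicit_oomd_runD(4)[OF run[OF that] 3(2)])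
    qed (rule xhat)
    with xhat 3 show ?thesis
      by simp
  qed
qed

section \<open>Noise and drift under a uniform gradient bound\<close>

context
  fixes G :: real
  assumes G: "0 \<le> G" and bounded: "\<And>g y. g \<in> space S \<Longrightarrow> y \<in> X \<Longrightarrow> norm (grad g y) \<le> G"
    and X_ne: "X \<noteq> {}"
begin

lemma norm_grad_expected_fun_le:
  assumes t: "t \<in> {1..T}" and \<omega>: "\<omega> \<in> space M" and y: "y \<in> X"
  shows "norm (grad (expected_fun (Dist t \<omega>)) y) \<le> G"
proof -
  interpret P: prob_space "Dist t \<omega>"
    using t \<omega> by (rule dist_prob_space)
  have "grad (expected_fun (Dist t \<omega>)) y = (\<integral>g. grad g y \<partial>Dist t \<omega>)"
    by (rule grad_eqI[OF interchange[OF t \<omega> y]])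
  then have "norm (grad (expected_fun (Dist t \<omega>)) y) = norm (\<integral>g. grad g y \<partial>Dist t \<omega>)"
    by simp
  also have "norm (\<integral>g. grad g y \<partial>Dist t \<omega>) \<le> (\<integral>g. norm (grad g y) \<partial>Dist t \<omega>)"
    by (rule integral_norm_bound)
  also have "(\<integral>g. norm (grad g y) \<partial>Dist t \<omega>) \<le> G"
  proof (cases "integrable (Dist t \<omega>) (\<lambda>g. norm (grad g y))")
    case True
    then show ?thesis
      using bounded[OF _ y] space_dist[OF t \<omega>] by (intro P.integral_le_const) auto
  next
    \<comment> \<open>Without integrability the integral has the default value \<open>0\<close>,
      still at most \<open>G\<close>.\<close>
    case False
    then show ?thesis
      using G by (simp add: not_integrable_integral_eq)
  qed
  finally show ?thesis .
qed

text \<open>The supremum dominates at all points simultaneously, so \<open>y\<close> may be chosen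
  in dependence on \<open>g\<close>. The uniform range makes everything below integrable.\<close>

lemma sup_noise_bounds:
  assumes t: "t \<in> {1..T}" and \<omega>: "\<omega> \<in> space M" and g: "g \<in> space S"
  shows "y \<in> X \<Longrightarrow> (norm (grad g y - grad (expected_fun (Dist t \<omega>)) y))\<^sup>2 \<le> sup_noise X (Dist t \<omega>) g"
    and "sup_noise X (Dist t \<omega>) g \<in> {0..(2 * G)\<^sup>2}"
  unfolding sup_noise_def
  using SUP_norm_diff_sq[where a = "grad g" and b = "grad (expected_fun (Dist t \<omega>))",
      OF bounded[OF g] norm_grad_expected_fun_le[OF t \<omega>] X_ne]
  by auto

lemma sup_drift_bounds:
  assumes t: "t \<in> {1..T}" and \<omega>: "\<omega> \<in> space M"
  shows "y \<in> X \<Longrightarrow> (norm (round_grad (\<lambda>s. expected_fun (Dist s \<omega>)) t y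
            - round_grad (\<lambda>s. expected_fun (Dist s \<omega>)) (t - 1) y))\<^sup>2
          \<le> sup_drift X (\<lambda>s. Dist s \<omega>) t"
    and "sup_drift X (\<lambda>s. Dist s \<omega>) t \<in> {0..(2 * G)\<^sup>2}"
proof -
  \<comment> \<open>At \<open>r = 0\<close> the gradient is zero by convention, so the drift of the
    first round is included.\<close>
  have le: "norm (round_grad (\<lambda>s. expected_fun (Dist s \<omega>)) r y) \<le> G" if "r \<le> T" "y \<in> X" for r y
    using norm_grad_expected_fun_le[of r \<omega> y] that \<omega> G by (auto simp: round_grad_def)
  have "t \<le> T" "t - 1 \<le> T"
    using t by auto
  note * = SUP_norm_diff_sq[where a = "round_grad (\<lambda>s. expected_fun (Dist s \<omega>)) t"
      and b = "round_grad (\<lambda>s. expected_fun (Dist s \<omega>)) (t - 1)",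
      OF le[OF \<open>t \<le> T\<close>] le[OF \<open>t - 1 \<le> T\<close>] X_ne]
  show "y \<in> X \<Longrightarrow> (norm (round_grad (\<lambda>s. expected_fun (Dist s \<omega>)) t y
            - round_grad (\<lambda>s. expected_fun (Dist s \<omega>)) (t - 1) y))\<^sup>2
          \<le> sup_drift X (\<lambda>s. Dist s \<omega>) t"
    unfolding sup_drift_def using *(1) .
  show "sup_drift X (\<lambda>s. Dist s \<omega>) t \<in> {0..(2 * G)\<^sup>2}"
    unfolding sup_drift_def using *(2) .
qed

text \<open>Inserting the expected gradients at \<open>z t\<close> splits each difference into three
  terms at the cost of a factor \<open>3\<close>. The noise of a round enters there and in the next
  round, giving \<open>6\<close>. In the second case the point may depend on the sample, which the
  supremum absorbs.\<close>

lemma sum_gradient_variation_le: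
  assumes \<omega>: "\<omega> \<in> space M" and z: "\<And>t. t \<in> {1..T} \<Longrightarrow> z t \<in> X"
  shows "(\<Sum>t=1..T. (norm (round_grad (\<lambda>t. f t \<omega>) t (z t) - round_grad (\<lambda>t. f t \<omega>) (t - 1) (z t)))\<^sup>2)
    \<le> 6 * (\<Sum>t=1..T. sup_noise X (Dist t \<omega>) (f t \<omega>)) + 3 * (\<Sum>t=1..T. sup_drift X (\<lambda>s. Dist s \<omega>) t)"
proof -
  let ?f = "round_grad (\<lambda>t. f t \<omega>)" and ?F = "round_grad (\<lambda>s. expected_fun (Dist s \<omega>))"
    and ?v = "sup_drift X (\<lambda>s. Dist s \<omega>)"
  \<comment> \<open>Setting \<open>n 0 = 0\<close> mirrors the vanishing gradients of round
    \<open>0\<close>.\<close>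
  define n where "n t = (if t = 0 then 0 else sup_noise X (Dist t \<omega>) (f t \<omega>))" for t
  have n: "(norm (?f t y - ?F t y))\<^sup>2 \<le> n t" "0 \<le> n t" if "t \<le> T" "y \<in> X" for t y
    using sup_noise_bounds(1)[of t \<omega> "f t \<omega>" y] sup_noise_bounds(2)[of t \<omega> "f t \<omega>"] that \<omega> sample_in_space[of t \<omega>]
    by (auto simp: n_def round_grad_def)
  \<comment> \<open>Since \<open>n 0 = 0\<close>, shifting the index only drops the last term, which
    is nonnegative.\<close>
  have shift: "(\<Sum>t=1..m. n (t - 1)) + n m = (\<Sum>t=1..m. n t)" for m
    by (induction m) (auto simp: n_def)
  have "(norm (?f t (z t) - ?f (t - 1) (z t)))\<^sup>2 \<le> 3 * (n t + ?v t + n (t - 1))"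
    if t: "t \<in> {1..T}" for t
  proof -
    have "?f t (z t) - ?f (t - 1) (z t) = (?f t (z t) - ?F t (z t))
        + (?F t (z t) - ?F (t - 1) (z t)) + (?F (t - 1) (z t) - ?f (t - 1) (z t))"
      by simp
    then have "(norm (?f t (z t) - ?f (t - 1) (z t)))\<^sup>2 \<le> 3 * ((norm (?f t (z t) - ?F t (z t)))\<^sup>2
        + (norm (?F t (z t) - ?F (t - 1) (z t)))\<^sup>2 + (norm (?f (t - 1) (z t) - ?F (t - 1) (z t)))\<^sup>2)"
      using norm_sum3_sq_le norm_minus_commute by metis
    also have "\<dots> \<le> 3 * (n t + ?v t + n (t - 1))"
      using n(1)[of t "z t"] n(1)[of "t - 1" "z t"] sup_drift_bounds(1)[OF t \<omega> z[OF t]] z[OF t] t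
      by (intro mult_left_mono add_mono) auto
    finally show ?thesis .
  qed
  then have "(\<Sum>t=1..T. (norm (?f t (z t) - ?f (t - 1) (z t)))\<^sup>2)
      \<le> (\<Sum>t=1..T. 3 * (n t + ?v t + n (t - 1)))"
    by (rule sum_mono)
  also have "\<dots> = 3 * (\<Sum>t=1..T. n t) + 3 * (\<Sum>t=1..T. ?v t) + 3 * (\<Sum>t=1..T. n (t - 1))"
    by (simp add: sum.distrib sum_distrib_left distrib_left)
  also have "\<dots> \<le> 6 * (\<Sum>t=1..T. n t) + 3 * (\<Sum>t=1..T. ?v t)"
    using shift[of T] n(2)[of T] X_ne by auto
  finally show ?thesis
    by (simp add: n_def)
qed

text \<open>Given \<open>Hist t\<close>, the sample has law \<open>Dist t\<close>, and averaging its
  noise over that law yields \<open>sigma_sq\<close>. The supremum has already removed the iterates,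
  so no independence of them is called for.\<close>

lemma noise_expectation:
  assumes t: "t \<in> {1..T}"
  shows "integrable M (\<lambda>\<omega>. sup_noise X (Dist t \<omega>) (f t \<omega>))"
    and "integrable M (\<lambda>\<omega>. sigma_sq X (Dist t \<omega>))"
    and "expectation (\<lambda>\<omega>. sup_noise X (Dist t \<omega>) (f t \<omega>)) = expectation (\<lambda>\<omega>. sigma_sq X (Dist t \<omega>))"
proof -
  note sub = hist_subalgebra[OF t]
  note noise_meas[measurable] = noise_measurable[OF t]
  have pair: "(\<lambda>\<omega>. (\<omega>, f t \<omega>)) \<in> M \<rightarrow>\<^sub>M Hist t \<Otimes>\<^sub>M S"
    using measurable_from_subalg[OF sub measurable_ident, unfolded id_def] sample_measurable[OF t]
    by (intro measurable_Pair) auto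
  have noise: "sup_noise X (Dist t \<omega>) g \<in> {0..(2 * G)\<^sup>2}" if "\<omega> \<in> space M" "g \<in> space S" for \<omega> g
    using sup_noise_bounds(2)[OF t that] .
  have "(\<lambda>\<omega>. sup_noise X (Dist t \<omega>) (f t \<omega>)) \<in> borel_measurable M"
    using measurable_compose[OF pair noise_meas] by simp
  then show int: "integrable M (\<lambda>\<omega>. sup_noise X (Dist t \<omega>) (f t \<omega>))"
    using noise sample_in_space[OF t] by (intro integrable_const_bound[where B = "(2 * G)\<^sup>2"]) auto
  have nn_dist: "(\<integral>\<^sup>+g. ennreal (sup_noise X (Dist t \<omega>) g) \<partial>Dist t \<omega>) = ennreal (sigma_sq X (Dist t \<omega>))"
    and sigma: "sigma_sq X (Dist t \<omega>) \<in> {0..(2 * G)\<^sup>2}"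
    if \<omega>: "\<omega> \<in> space M" for \<omega>
  proof -
    interpret P: prob_space "Dist t \<omega>"
      using t \<omega> by (rule dist_prob_space)
    have "\<omega> \<in> space (Hist t)"
      using \<omega> sub by (simp add: subalgebra_def)
    then have "sup_noise X (Dist t \<omega>) \<in> borel_measurable S"
      using measurable_compose[OF measurable_Pair1' noise_meas] by simp
    then have "sup_noise X (Dist t \<omega>) \<in> borel_measurable (Dist t \<omega>)"
      using sets_dist[OF t \<omega>] by (simp cong: measurable_cong_sets)
    then have int: "integrable (Dist t \<omega>) (sup_noise X (Dist t \<omega>))"
      using noise[OF \<omega>] space_dist[OF t \<omega>]
      by (intro P.integrable_const_bound[where B = "(2 * G)\<^sup>2"]) auto
    show "(\<integral>\<^sup>+g. ennreal (sup_noise X (Dist t \<omega>) g) \<partial>Dist t \<omega>) = ennreal (sigma_sq X (Dist t \<omega>))"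
      unfolding sigma_sq_def using noise[OF \<omega>] space_dist[OF t \<omega>]
      by (intro nn_integral_eq_integral int) auto
    show "sigma_sq X (Dist t \<omega>) \<in> {0..(2 * G)\<^sup>2}"
      unfolding sigma_sq_def using noise[OF \<omega>] space_dist[OF t \<omega>]
      by (auto intro!: P.integral_le_const int integral_nonneg_AE)
  qed
  \<comment> \<open>Measurability of \<open>sigma_sq\<close> is obtained through the nonnegative
    integral against the kernel \<open>Dist t\<close>, whose finite value it is.\<close>
  have "(\<lambda>\<omega>. \<integral>\<^sup>+g. ennreal (sup_noise X (Dist t \<omega>) g) \<partial>Dist t \<omega>) \<in> borel_measurable (Hist t)"
    by (rule nn_integral_measurable_subprob_algebra2[OF _ measurable_prob_algebraD[OF dist_chosen[OF t]]])
       measurable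
  then have "(\<lambda>\<omega>. \<integral>\<^sup>+g. ennreal (sup_noise X (Dist t \<omega>) g) \<partial>Dist t \<omega>) \<in> borel_measurable M"
    by (rule measurable_from_subalg[OF sub])
  then have "(\<lambda>\<omega>. enn2real (\<integral>\<^sup>+g. ennreal (sup_noise X (Dist t \<omega>) g) \<partial>Dist t \<omega>)) \<in> borel_measurable M"
    by measurable
  moreover have "enn2real (\<integral>\<^sup>+g. ennreal (sup_noise X (Dist t \<omega>) g) \<partial>Dist t \<omega>) = sigma_sq X (Dist t \<omega>)"
    if "\<omega> \<in> space M" for \<omega>
    using nn_dist[OF that] sigma[OF that] by simp
  ultimately have "(\<lambda>\<omega>. sigma_sq X (Dist t \<omega>)) \<in> borel_measurable M"
    by (simp cong: measurable_cong)
  then show int': "integrable M (\<lambda>\<omega>. sigma_sq X (Dist t \<omega>))"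
    using sigma by (intro integrable_const_bound[where B = "(2 * G)\<^sup>2"]) auto
  have "ennreal (expectation (\<lambda>\<omega>. sup_noise X (Dist t \<omega>) (f t \<omega>)))
      = (\<integral>\<^sup>+\<omega>. ennreal (sup_noise X (Dist t \<omega>) (f t \<omega>)) \<partial>M)"
    using noise sample_in_space[OF t] by (intro nn_integral_eq_integral[symmetric] int) auto
  also have "\<dots> = (\<integral>\<^sup>+\<omega>. (\<integral>\<^sup>+g. ennreal (sup_noise X (Dist t \<omega>) g) \<partial>Dist t \<omega>) \<partial>M)"
    using nn_integral_disintegration[OF prob_space_axioms sub sample_measurable[OF t] dist_chosen[OF t]
        sample_law[OF t], of "\<lambda>(\<omega>, g). ennreal (sup_noise X (Dist t \<omega>) g)"]
    by simp
  also have "\<dots> = (\<integral>\<^sup>+\<omega>. ennreal (sigma_sq X (Dist t \<omega>)) \<partial>M)"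
    by (rule nn_integral_cong) (rule nn_dist)
  also have "\<dots> = ennreal (expectation (\<lambda>\<omega>. sigma_sq X (Dist t \<omega>)))"
    using sigma by (intro nn_integral_eq_integral int') auto
  finally show "expectation (\<lambda>\<omega>. sup_noise X (Dist t \<omega>) (f t \<omega>)) = expectation (\<lambda>\<omega>. sigma_sq X (Dist t \<omega>))"
    using noise sigma sample_in_space[OF t]
    by (subst (asm) ennreal_inj) (auto intro!: integral_nonneg_AE)
qed

text \<open>Jensen moves the expectation under the root, where the noise of the samples averages to
  \<open>sigma_sq\<close> round by round.\<close>

lemma expectation_sqrt_noise_le:
  shows "integrable M (\<lambda>\<omega>. sqrt (\<Sum>t=1..T. sup_noise X (Dist t \<omega>) (f t \<omega>)))"
    and "expectation (\<lambda>\<omega>. sqrt (\<Sum>t=1..T. sup_noise X (Dist t \<omega>) (f t \<omega>)))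
      \<le> sqrt (cum_sigma_sq M T X Dist)"
proof -
  let ?N = "\<lambda>\<omega>. \<Sum>t=1..T. sup_noise X (Dist t \<omega>) (f t \<omega>)"
  have int: "integrable M ?N"
    by (intro Bochner_Integration.integrable_sum noise_expectation)
  have pos: "0 \<le> ?N \<omega>" if "\<omega> \<in> space M" for \<omega>
    using sup_noise_bounds(2)[OF _ that sample_in_space] that by (auto intro!: sum_nonneg)
  have "expectation ?N = cum_sigma_sq M T X Dist"
    unfolding cum_sigma_sq_def using noise_expectation by simp
  with expectation_sqrt_le[OF int pos]
  show "integrable M (\<lambda>\<omega>. sqrt (?N \<omega>))" "expectation (\<lambda>\<omega>. sqrt (?N \<omega>)) \<le> sqrt (cum_sigma_sq M T X Dist)"
    by auto
qed

lemma expectation_sqrt_drift_le: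
  shows "integrable M (\<lambda>\<omega>. sqrt (\<Sum>t=1..T. sup_drift X (\<lambda>s. Dist s \<omega>) t))"
    and "expectation (\<lambda>\<omega>. sqrt (\<Sum>t=1..T. sup_drift X (\<lambda>s. Dist s \<omega>) t))
      \<le> sqrt (cum_Sigma_sq M T X Dist)"
proof -
  let ?V = "\<lambda>\<omega>. \<Sum>t=1..T. sup_drift X (\<lambda>s. Dist s \<omega>) t"
  have int: "integrable M ?V"
    using sup_drift_bounds(2)
    by (intro Bochner_Integration.integrable_sum integrable_const_bound[where B = "(2 * G)\<^sup>2"]
        drift_measurable) auto
  have pos: "0 \<le> ?V \<omega>" if "\<omega> \<in> space M" for \<omega>
    using sup_drift_bounds(2)[OF _ that] by (auto intro!: sum_nonneg)
  show "integrable M (\<lambda>\<omega>. sqrt (?V \<omega>))" "expectation (\<lambda>\<omega>. sqrt (?V \<omega>)) \<le> sqrt (cum_Sigma_sq M T X Dist)"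
    unfolding cum_Sigma_sq_def using expectation_sqrt_le[OF int pos] by auto
qed

end

end

text \<open>Eventually \<open>s + v\<close> is at least \<open>1\<close>, hence so is
  \<open>sqrt s + sqrt v\<close>, and the constant \<open>c\<close> is absorbed.\<close>

lemma sqrt_bound_in_bigo:
  "(\<lambda>(s, v). c + a * sqrt s + b * sqrt v) \<in> O[large_nonneg_sum](\<lambda>(s, v). sqrt s + sqrt v)"
proof (rule bigoI)
  have "\<forall>\<^sub>F p in large_nonneg_sum. p \<in> {0..} \<times> {0..}"
    unfolding large_nonneg_sum_def by (auto simp: eventually_inf_principal)
  moreover have "\<forall>\<^sub>F p in large_nonneg_sum. 1 \<le> (case p of (s, v) \<Rightarrow> s + v)"
    unfolding large_nonneg_sum_def
    using filterlim_filtercomap[of "\<lambda>(s, v). s + v :: real" at_top] eventually_ge_at_top[of "1 :: real"]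
    by (intro filter_leD[OF inf_le1]) (auto simp: filterlim_iff)
  ultimately show "\<forall>\<^sub>F p in large_nonneg_sum. norm (case p of (s, v) \<Rightarrow> c + a * sqrt s + b * sqrt v)
      \<le> (\<bar>c\<bar> + \<bar>a\<bar> + \<bar>b\<bar>) * norm (case p of (s, v) \<Rightarrow> sqrt s + sqrt v)"
  proof eventually_elim
    case (elim p)
    obtain s v where p: "p = (s, v)"
      by (cases p)
    with elim have sv: "0 \<le> s" "0 \<le> v" "1 \<le> s + v"
      by auto
    have "1 \<le> sqrt (s + v)"
      using sv(3) by simp
    also have "\<dots> \<le> sqrt s + sqrt v"
      using sv by (intro sqrt_add_le_add_sqrt)
    finally have "\<bar>c\<bar> * 1 \<le> \<bar>c\<bar> * (sqrt s + sqrt v)"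
      by (intro mult_left_mono) auto
    moreover have "\<bar>a\<bar> * sqrt s \<le> \<bar>a\<bar> * (sqrt s + sqrt v)" "\<bar>b\<bar> * sqrt v \<le> \<bar>b\<bar> * (sqrt s + sqrt v)"
      using sv by (auto intro!: mult_left_mono)
    moreover have "\<bar>c + a * sqrt s + b * sqrt v\<bar> \<le> \<bar>c\<bar> + \<bar>a\<bar> * sqrt s + \<bar>b\<bar> * sqrt v"
      using sv abs_triangle_ineq[of "c + a * sqrt s" "b * sqrt v"] abs_triangle_ineq[of c "a * sqrt s"]
      by (simp add: abs_mult)
    ultimately show ?case
      using sv by (simp add: p distrib_right)
  qed
qed

theorem theorem8:
  fixes M :: "'w measure"
    and T :: nat
    and X :: "'a::euclidean_space set"
    and S :: "('a \<Rightarrow> real) measure"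
    and Hist :: "nat \<Rightarrow> 'w measure"
    and Dist :: "nat \<Rightarrow> 'w \<Rightarrow> ('a \<Rightarrow> real) measure"
    and f :: "nat \<Rightarrow> 'w \<Rightarrow> 'a \<Rightarrow> real"
    and G D :: real
    and x1 u :: 'a
    and x xhat :: "nat \<Rightarrow> 'w \<Rightarrow> 'a"
  assumes sea: "sea_model M T X S Hist Dist f"
    and G_pos: "G > 0" and D_pos: "D > 0"
    and bounded_gradients: "\<And>g y. g \<in> space S \<Longrightarrow> y \<in> X \<Longrightarrow> norm (grad g y) \<le> G"
    and zero_in_domain: "0 \<in> X"
    and bounded_domain: "\<And>y z. y \<in> X \<Longrightarrow> z \<in> X \<Longrightarrow> norm (y - z) \<le> D"
    and convex_functions: "\<And>g. g \<in> space S \<Longrightarrow> convex_on X g"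
    and initial: "x1 \<in> X"
    and run: "\<And>\<omega>. \<omega> \<in> space M \<Longrightarrow>
          implicit_oomd_run X D G T (\<lambda>t. f t \<omega>) x1 (\<lambda>t. x t \<omega>) (\<lambda>t. xhat t \<omega>)"
    and comparator: "u \<in> X"
  shows "integrable M (\<lambda>\<omega>. (\<Sum>t=1..T. f t \<omega> (x t \<omega>)) - (\<Sum>t=1..T. f t \<omega> u)) \<and>
         (\<integral>\<omega>. ((\<Sum>t=1..T. f t \<omega> (x t \<omega>)) - (\<Sum>t=1..T. f t \<omega> u)) \<partial>M)
           \<le> 5 * D * sqrt (1 + G\<^sup>2)
             + 10 * sqrt 2 * D * sqrt (cum_sigma_sq M T X Dist)
             + 10 * D * sqrt (cum_Sigma_sq M T X Dist) \<and>
         (\<lambda>(s, v). 5 * D * sqrt (1 + G\<^sup>2) + 10 * sqrt 2 * D * sqrt s + 10 * D * sqrt v)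
           \<in> O[large_nonneg_sum](\<lambda>(s, v). sqrt s + sqrt v)"
proof -
  interpret sea_model M T X S Hist Dist f
    by (rule sea)
  have G: "0 \<le> G" and X_ne: "X \<noteq> {}"
    using G_pos initial by auto
  have in_X: "x t \<omega> \<in> X" if "t \<in> {1..T}" "\<omega> \<in> space M" for t \<omega>
    using implicit_oomd_in_domain[OF run[OF that(2)] initial, of t] that(1) by simp
  have x_meas: "x t \<in> borel_measurable M" if "t \<in> {1..T}" for t
    using borel_measurable_iterates[OF D_pos convex_functions initial run order_refl, of t] that
    by simp
  let ?R = "\<lambda>\<omega>. (\<Sum>t=1..T. f t \<omega> (x t \<omega>)) - (\<Sum>t=1..T. f t \<omega> u)"
  have int_R: "integrable M ?R"
    unfolding sum_subtractf[symmetric]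
  proof (rule Bochner_Integration.integrable_sum)
    fix t assume t: "t \<in> {1..T}"
    show "integrable M (\<lambda>\<omega>. f t \<omega> (x t \<omega>) - f t \<omega> u)"
    proof (rule integrable_const_bound[where B = "G * D"])
      show "(\<lambda>\<omega>. f t \<omega> (x t \<omega>) - f t \<omega> u) \<in> borel_measurable M"
        using t in_X x_meas comparator
        by (intro borel_measurable_diff borel_measurable_sample_eval) auto
      \<comment> \<open>Convexity and Cauchy-Schwarz bound the variation of every function over
        \<open>X\<close>; using the bound in both orders controls the absolute value.\<close>
      have "h y - h z \<le> G * D" if h: "h \<in> space S" and yz: "y \<in> X" "z \<in> X" for h y z
      proof -
        have "grad h y \<bullet> (z - y) \<le> h z - h y"
          using yz by (intro convex_on_gradient_ineq[OF convex_functions[OF h]] GDERIV_grad differentiable[OF h])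
        then have "h y - h z \<le> grad h y \<bullet> (y - z)"
          by (simp add: inner_diff_right)
        also have "\<dots> \<le> norm (grad h y) * norm (y - z)"
          by (rule norm_cauchy_schwarz)
        also have "\<dots> \<le> G * D"
          using bounded_gradients[OF h yz(1)] bounded_domain[OF yz] G by (intro mult_mono) auto
        finally show ?thesis .
      qed
      then show "AE \<omega> in M. norm (f t \<omega> (x t \<omega>) - f t \<omega> u) \<le> G * D"
        using in_X[OF t] sample_in_space[OF t] comparator by (auto simp: abs_le_iff)
    qed
  qed
  let ?N = "\<lambda>\<omega>. \<Sum>t=1..T. sup_noise X (Dist t \<omega>) (f t \<omega>)"
    and ?V = "\<lambda>\<omega>. \<Sum>t=1..T. sup_drift X (\<lambda>s. Dist s \<omega>) t"
  note noise = expectation_sqrt_noise_le[OF G bounded_gradients X_ne]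
    and drift = expectation_sqrt_drift_le[OF G bounded_gradients X_ne]
  have pathwise: "?R \<omega> \<le> 5 * D * sqrt (1 + G\<^sup>2) + 10 * sqrt 2 * D * sqrt (?N \<omega>) + 10 * D * sqrt (?V \<omega>)"
    if \<omega>: "\<omega> \<in> space M" for \<omega>
  proof -
    let ?A = "\<Sum>t=1..T. (norm (round_grad (\<lambda>t. f t \<omega>) t (x t \<omega>)
        - round_grad (\<lambda>t. f t \<omega>) (t - 1) (x t \<omega>)))\<^sup>2"
    have N: "0 \<le> ?N \<omega>"
      using sup_noise_bounds(2)[OF G bounded_gradients X_ne _ \<omega> sample_in_space] \<omega>
      by (auto intro!: sum_nonneg)
    have V: "0 \<le> ?V \<omega>"
      using sup_drift_bounds(2)[OF G bounded_gradients X_ne _ \<omega>] by (auto intro!: sum_nonneg)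
    have "?R \<omega> \<le> D * sqrt (1 + G\<^sup>2) + 3 / 2 * D * sqrt ?A"
      by (rule implicit_oomd_regret[OF run[OF \<omega>] initial D_pos convex_domain])
         (use sample_in_space[OF _ \<omega>] differentiable convex_functions bounded_gradients
           bounded_domain comparator in auto)
    \<comment> \<open>The coefficients \<open>6\<close> and \<open>3\<close> are enlarged to
      \<open>18\<close> and \<open>4\<close> so that their roots are \<open>3 * sqrt 2\<close> and
      \<open>2\<close>.\<close>
    moreover have "sqrt ?A \<le> 3 * sqrt 2 * sqrt (?N \<omega>) + 2 * sqrt (?V \<omega>)"
    proof -
      have "?A \<le> 6 * ?N \<omega> + 3 * ?V \<omega>"
        using in_X \<omega> by (intro sum_gradient_variation_le[OF G bounded_gradients X_ne]) auto
      also have "\<dots> \<le> 18 * ?N \<omega> + 4 * ?V \<omega>"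
        using N V by simp
      finally have "sqrt ?A \<le> sqrt (18 * ?N \<omega> + 4 * ?V \<omega>)"
        by simp
      also have "\<dots> \<le> sqrt (3\<^sup>2 * 2 * ?N \<omega>) + sqrt (2\<^sup>2 * ?V \<omega>)"
        using sqrt_add_le_add_sqrt[of "18 * ?N \<omega>" "4 * ?V \<omega>"] N V by simp
      finally show ?thesis
        unfolding real_sqrt_mult by simp
    qed
    then have "D * sqrt ?A \<le> D * (3 * sqrt 2 * sqrt (?N \<omega>) + 2 * sqrt (?V \<omega>))"
      using D_pos by (intro mult_left_mono) auto
    \<comment> \<open>Multiplied by \<open>3 / 2\<close>, the coefficients are \<open>1\<close>,
      \<open>9 / 2 * sqrt 2\<close> and \<open>3\<close>; nonnegativity of the three quantities
      allows the larger \<open>5\<close>, \<open>10 * sqrt 2\<close> and \<open>10\<close>.\<close>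
    moreover have "0 \<le> D * sqrt (1 + G\<^sup>2)" "0 \<le> D * (sqrt 2 * sqrt (?N \<omega>))" "0 \<le> D * sqrt (?V \<omega>)"
      using D_pos N V by auto
    ultimately show ?thesis
      by (simp add: algebra_simps)
  qed
  have "expectation ?R \<le> expectation (\<lambda>\<omega>. 5 * D * sqrt (1 + G\<^sup>2)
      + 10 * sqrt 2 * D * sqrt (?N \<omega>) + 10 * D * sqrt (?V \<omega>))"
    by (rule integral_mono[OF int_R _ pathwise]) (use noise(1) drift(1) in auto)
  also have "\<dots> = 5 * D * sqrt (1 + G\<^sup>2) + 10 * sqrt 2 * D * expectation (\<lambda>\<omega>. sqrt (?N \<omega>))
      + 10 * D * expectation (\<lambda>\<omega>. sqrt (?V \<omega>))"
    using noise(1) drift(1) by (simp add: prob_space)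
  also have "\<dots> \<le> 5 * D * sqrt (1 + G\<^sup>2) + 10 * sqrt 2 * D * sqrt (cum_sigma_sq M T X Dist)
      + 10 * D * sqrt (cum_Sigma_sq M T X Dist)"
    using noise(2) drift(2) D_pos by (intro add_mono mult_left_mono order_refl) auto
  finally show ?thesis
    using int_R sqrt_bound_in_bigo by blast
qed

end
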